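(* Let $X$ be a $T_3$ space, let $\lambda$ be a cardinal and let $X_\lambda=\{p\in X:\varrho(p,X)=\lambda\}$. Then $X_\lambda$ has a Noetherian outer base $\mathcal B_\lambda$ in $X$.
   Context: For an open set $G$, $\mathrm{RO}(G)$ is the family of regular open subsets of $G$ and $\rho(G)=|\mathrm{RO}(G)|$. For $p\in X$, $\varrho(p,X)=\min\{\rho(G): p\in G,\ G\text{ open in }X\}$. For $Y\subseteq X$, a family $\mathcal B$ of open subsets of $X$ is an outer base of $Y$ in $X$ if for each $p\in Y$, $\{G\in\mathcal B:p\in G\}$ is a neighbourhood base of $p$ in $X$; it is Noetherian if it contains no infinite strictly $\subseteq$-increasing sequence. *)

theory Defs
  imports "HOL-Analysis.Analysis" "HOL-Library.Equipollence"
begin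

definition regular_open_in :: "'a topology \<Rightarrow> 'a set \<Rightarrow> bool" where
  "regular_open_in T U \<longleftrightarrow> T interior_of (T closure_of U) = U"

definition RO :: "'a topology \<Rightarrow> 'a set \<Rightarrow> 'a set set" where
  "RO X G = {U. regular_open_in (subtopology X G) U}"

text \<open>The cardinal varrho(p,X) equals the cardinal of the set L, i.e.
  the minimum of |RO(G)| over open G containing p is |L|.\<close>
definition rho_point_eq :: "'a topology \<Rightarrow> 'a \<Rightarrow> 'b set \<Rightarrow> bool" where
  "rho_point_eq X p L \<longleftrightarrow>
     (\<exists>G. openin X G \<and> p \<in> G \<and> RO X G \<approx> L) \<and>
     (\<forall>G. openin X G \<and> p \<in> G \<longrightarrow> L \<lesssim> RO X G)"

definition X_card :: "'a topology \<Rightarrow> 'b set \<Rightarrow> 'a set" where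
  "X_card X L = {p \<in> topspace X. rho_point_eq X p L}"

definition outer_base :: "'a topology \<Rightarrow> 'a set set \<Rightarrow> 'a set \<Rightarrow> bool" where
  "outer_base X \<B> Y \<longleftrightarrow> (\<forall>B\<in>\<B>. openin X B) \<and>
     (\<forall>p\<in>Y. \<forall>U. openin X U \<and> p \<in> U \<longrightarrow> (\<exists>B\<in>\<B>. p \<in> B \<and> B \<subseteq> U))"

definition noetherian :: "'a set set \<Rightarrow> bool" where
  "noetherian \<B> \<longleftrightarrow> \<not> (\<exists>f :: nat \<Rightarrow> 'a set. \<forall>n. f n \<in> \<B> \<and> f n \<subset> f (Suc n))"

definition T3_space :: "'a topology \<Rightarrow> bool" where
  "T3_space X \<longleftrightarrow> t1_space X \<and> regular_space X"

end

theory Submission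
  imports Defs
begin

text \<open>Write \<open>\<rho>(U)\<close> for the number of regular open subsets of \<open>U\<close>. The points of \<open>X\<^sub>\<lambda>\<close> are of two kinds.
  If \<open>q\<close> has a neighbourhood \<open>U\<close> such that every regular open \<open>W \<subseteq> U\<close> with \<open>q \<notin> cl W\<close> has
  \<open>\<rho>(W) < \<lambda>\<close>, then \<open>U\<close> contains no other point of \<open>X\<^sub>\<lambda>\<close>, and it suffices to choose a Noetherian
  local base below \<open>U\<close> at each such \<open>q\<close>.

  Around the other points every small \<open>U\<close> contains two regular open sets \<open>C\<close>, \<open>C'\<close> with disjoint
  closures and \<open>\<rho>(C) = \<rho>(C') = \<lambda>\<close>. Taking the first pair, in a fixed well-order, that can serve \<open>U\<close>,
  and \<open>q \<notin> cl C\<close>, one replaces \<open>U\<close> by \<open>(U - cl C) \<union> S\<close>, where \<open>S \<subseteq> U \<inter> C\<close> encodes a colour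
  \<open>c(U - cl C) < \<lambda>\<close>. Along an increasing chain the pair is eventually constant because it can only
  move down in the well-order. The encoding is such that then also \<open>S\<close> and the colour are
  eventually constant, and the colouring distinguishes nested sets, so the chain stops.

  The encoding uses that \<open>\<rho>(C)\<close> is attained as the size of an inclusion antichain of regular open
  subsets of \<open>C\<close>. The colouring reduces, by cutting \<open>U\<close> along a maximal disjoint family of cells all
  of whose non-empty regular open subsets have the same \<open>\<rho>\<close>, to colouring the subsets of size at
  most \<open>\<theta>\<close> of an arbitrary set with \<open>2\<^sup>\<theta>\<close> colours so that nested sets get different colours.\<close>

section \<open>Cardinality and well-orders\<close>

unbundle cardinal_syntax

lemma lepoll_iff_card_of_ordLeq: "A \<lesssim> B \<longleftrightarrow> |A| \<le>o |B|"
  by (simp add: lepoll_def card_of_ordLeq)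

lemma times_self_lepoll: "infinite N \<Longrightarrow> N \<times> N \<lesssim> N"
  by (simp add: lepoll_iff_card_of_ordLeq card_of_Times_same_infinite ordIso_imp_ordLeq)

lemma sum_self_lepoll: "infinite N \<Longrightarrow> N <+> N \<lesssim> N"
  using card_of_Plus_infinite1[OF _ ordLeq_refl[OF card_of_Card_order]]
  by (auto simp: lepoll_iff_card_of_ordLeq intro: ordIso_imp_ordLeq)

lemma exists_lepoll_minimal:
  fixes f :: "'x \<Rightarrow> 'y set"
  assumes "S \<noteq> {}"
  shows "\<exists>x\<in>S. \<forall>y\<in>S. f x \<lesssim> f y"
proof -
  have "wf (inv_image ordLess (\<lambda>x. |f x| ))"
    using wf_ordLess by (rule wf_inv_image)
  then obtain x where "x \<in> S" and "\<And>y. (y, x) \<in> inv_image ordLess (\<lambda>x. |f x| ) \<Longrightarrow> y \<notin> S"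
    using assms by (metis wfE_min ex_in_conv)
  then have "\<not> |f y| <o |f x|" if "y \<in> S" for y
    using that by (auto simp: inv_image_def)
  then show ?thesis
    using \<open>x \<in> S\<close> by (meson lepoll_iff_card_of_ordLeq not_ordLess_iff_ordLeq card_of_Well_order)
qed

text \<open>\<open>|D|\<close> is a well-order of \<open>D\<close> of least order type, so initial
  segments below a point have fewer elements than \<open>D\<close>. On a whole type it serves as an
  arbitrary fixed well-order.\<close>

definition card_less :: "'a set \<Rightarrow> ('a \<times> 'a) set" where
  "card_less D = |D| - Id"

lemma wf_card_less: "wf (card_less D)"
  unfolding card_less_def using card_of_well_order_on[of D] by (simp add: well_order_on_def)

lemma trans_card_less: "trans (card_less D)"
proof -
  have "partial_order_on D |D|"
    using card_of_well_order_on[of D] by (simp add: well_order_on_def linear_order_on_def)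
  then show ?thesis
    unfolding card_less_def partial_order_on_def preorder_on_def by (simp add: trans_diff_Id)
qed

lemma total_card_less: "x \<in> D \<Longrightarrow> y \<in> D \<Longrightarrow> x = y \<or> (x, y) \<in> card_less D \<or> (y, x) \<in> card_less D"
  using card_of_well_order_on[of D]
  by (auto simp: card_less_def well_order_on_def linear_order_on_def total_on_def)

lemma underS_card_of: "underS |D| x = {y. (y, x) \<in> card_less D}"
  by (auto simp: underS_def card_less_def)

lemma card_less_in: "(y, x) \<in> card_less D \<Longrightarrow> y \<in> D"
  using card_of_well_order_on[of D]
  by (metis DiffE FieldI1 card_less_def well_order_on_Field)

lemma segment_card_less: "x \<in> D \<Longrightarrow> \<not> D \<lesssim> {y. (y, x) \<in> card_less D}"
  using card_of_underS[OF card_of_Card_order, of x D]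
  by (metis Field_card_of card_of_Well_order lepoll_iff_card_of_ordLeq not_ordLess_iff_ordLeq underS_card_of)

lemma eqpoll_segment:
  assumes "M \<lesssim> D" "\<not> D \<lesssim> M"
  shows "\<exists>x\<in>D. M \<approx> {y. (y, x) \<in> card_less D}"
proof -
  have "|M| <o |D|"
    using assms by (meson card_of_Well_order lepoll_iff_card_of_ordLeq not_ordLess_iff_ordLeq)
  then obtain x where x: "x \<in> D" and iso: "|M| =o Restr |D| (underS |D| x)"
    using ordLess_iff_ordIso_Restr[OF card_of_Well_order card_of_Well_order, of M D]
    by (auto simp: Field_card_of)
  have "wo_rel |D|" by (simp add: wo_rel_def card_of_Well_order)
  then have "Field (Restr |D| (underS |D| x)) = underS |D| x"
    by (rule Field_Restr_ofilter[OF card_of_Well_order wo_rel.underS_ofilter])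
  then have "|M| =o |underS |D| x|"
    using ordIso_transitive[OF iso ordIso_symmetric[OF card_of_Field_ordIso[OF
      Card_order_ordIso2[OF card_of_Card_order iso]]]] by simp
  then show ?thesis
    using x by (auto simp: eqpoll_iff_card_of_ordIso underS_card_of)
qed

text \<open>A set smaller than \<open>D\<close> is equipollent to an initial segment of
  \<open>D\<close> and is coded by the end point of that segment; full size gets one extra code,
  which an infinite \<open>D\<close> can absorb. A code determines the cardinality; nothing is
  claimed in the other direction.\<close>

lemma equipollence_classes:
  fixes D :: "'d set"
  assumes "infinite D"
  shows "\<exists>cls :: 'm set \<Rightarrow> 'd. (\<forall>M. M \<lesssim> D \<longrightarrow> cls M \<in> D) \<and>
           (\<forall>M M'. M \<lesssim> D \<longrightarrow> M' \<lesssim> D \<longrightarrow> cls M = cls M' \<longrightarrow> M \<approx> M')"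
proof -
  have "insert None (Some ` D) \<lesssim> D"
    by (meson assms finite_imageD image_lepoll infinite_insert_lepoll inj_Some inj_on_subset lepoll_trans subset_UNIV
        infinite_insert_eqpoll eqpoll_imp_lepoll)
  then obtain h where h: "inj_on h (insert None (Some ` D))" "h ` insert None (Some ` D) \<subseteq> D"
    by (auto simp: lepoll_def)
  obtain s where s: "\<And>M::'m set. M \<lesssim> D \<Longrightarrow> \<not> D \<lesssim> M \<Longrightarrow> s M \<in> D \<and> M \<approx> {y. (y, s M) \<in> card_less D}"
    using eqpoll_segment by metis
  define c where "c M = h (if D \<lesssim> M then None else Some (s M))" for M :: "'m set"
  have "c M \<in> D" if "M \<lesssim> D" for M
    using h(2) s[OF that] unfolding c_def image_subset_iff by auto
  moreover have "M \<approx> M'" if "M \<lesssim> D" "M' \<lesssim> D" "c M = c M'" for M M'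
  proof -
    have "(if D \<lesssim> M then None else Some (s M)) = (if D \<lesssim> M' then None else Some (s M'))"
      by (rule inj_onD[OF h(1)]) (use that s in \<open>auto simp: c_def\<close>)
    then consider "D \<lesssim> M" "D \<lesssim> M'" | "\<not> D \<lesssim> M" "\<not> D \<lesssim> M'" "s M = s M'"
      by (auto split: if_splits)
    then show ?thesis
    proof cases
      case 1
      then show ?thesis using that by (meson lepoll_antisym lepoll_trans)
    next
      case 2
      then show ?thesis using s that by (metis eqpoll_sym eqpoll_trans)
    qed
  qed
  ultimately show ?thesis by blast
qed

text \<open>Zorn's lemma. The map \<open>z\<close> lets it apply to pairs of sets through their
  union.\<close>

lemma maximal_disjoint_subfamily:
  "\<exists>I\<subseteq>J. disjoint_family_on z I \<and> (\<forall>j\<in>J. (\<forall>i\<in>I. z i \<inter> z j = {}) \<longrightarrow> j \<in> I)"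
proof -
  let ?A = "{I. I \<subseteq> J \<and> disjoint_family_on z I}"
  have "\<exists>M\<in>?A. \<forall>X\<in>?A. M \<subseteq> X \<longrightarrow> X = M"
  proof (rule Zorn_Lemma, intro ballI)
    fix C assume C: "C \<in> chains ?A"
    have "disjoint_family_on z (\<Union>C)"
      unfolding disjoint_family_on_def
    proof (intro ballI impI)
      fix i j assume "i \<in> \<Union>C" "j \<in> \<Union>C" "i \<noteq> j"
      then obtain I where "I \<in> C" "i \<in> I" "j \<in> I"
        using C unfolding chains_def chain_subset_def by blast
      then show "z i \<inter> z j = {}"
        using C \<open>i \<noteq> j\<close> unfolding chains_def disjoint_family_on_def by blast
    qed
    then show "\<Union>C \<in> ?A"
      using C by (auto simp: chains_def)
  qed
  then obtain I where I: "I \<subseteq> J" "disjoint_family_on z I"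
    and max: "\<And>I'. I' \<subseteq> J \<Longrightarrow> disjoint_family_on z I' \<Longrightarrow> I \<subseteq> I' \<Longrightarrow> I' = I"
    by auto
  have "j \<in> I" if "j \<in> J" "\<forall>i\<in>I. z i \<inter> z j = {}" for j
    using max[of "insert j I"] I that by (auto simp: disjoint_family_on_def)
  with I show ?thesis by blast
qed

lemma wf_descending_eventually_constant:
  assumes "wf r" and step: "\<And>n::nat. (f (Suc n), f n) \<in> r \<or> f (Suc n) = f n"
  shows "\<exists>m. \<forall>n\<ge>m. f n = f m"
proof -
  obtain y where y: "y \<in> range f" and min: "\<And>x. (x, y) \<in> r \<Longrightarrow> x \<notin> range f"
    using wfE_min[OF assms(1), of "f 0" "range f"] by blast
  then obtain m where m: "y = f m" by blast
  have "f n = f m" if "n \<ge> m" for n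
    using that by (induction rule: dec_induct) (use step min m in \<open>metis rangeI\<close>)+
  then show ?thesis by blast
qed

text \<open>The inductive step bounds sets that are not cofinal by their strict supremum. This supremum
  agrees for nested sets of the same order type, because a set is cofinal in any superset of the
  same order type.\<close>
lemma inclusion_coloring:
  fixes N :: "'n set"
  assumes "infinite N"
  shows "\<exists>w :: 's set \<Rightarrow> 'n set. (\<forall>K. w K \<subseteq> N) \<and>
           (\<forall>K K'. K \<subseteq> K' \<longrightarrow> K' \<lesssim> N \<longrightarrow> w K = w K' \<longrightarrow> K = K')"
proof -
  define lt where "lt = card_less (UNIV :: 's set)"
  note wf = wf_card_less[of "UNIV :: 's set", folded lt_def]
  note trans = trans_card_less[of "UNIV :: 's set", folded lt_def]
  note total = total_card_less[of _ "UNIV :: 's set", folded lt_def, simplified]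
  define seg where "seg x = {y. (y, x) \<in> lt}" for x
  \<comment> \<open>Relativised to \<open>I\<close>, the property can be proved for all initial
    segments by well-founded induction and then for the whole type.\<close>
  define good where "good I w \<longleftrightarrow> (\<forall>K. w K \<subseteq> N) \<and>
      (\<forall>K K'. K \<subseteq> K' \<longrightarrow> K' \<subseteq> I \<longrightarrow> K' \<lesssim> N \<longrightarrow> w K = w K' \<longrightarrow> K = K')"
    for I and w :: "'s set \<Rightarrow> 'n set"
  have goodD: "K = K'" if "good I w" "K \<subseteq> K'" "K' \<subseteq> I" "K' \<lesssim> N" "w K = w K'" for I w K K'
    using that unfolding good_def by blast
  have goodI: "good I w" if "\<And>K. w K \<subseteq> N"
    "\<And>K K'. K \<subseteq> K' \<Longrightarrow> K' \<subseteq> I \<Longrightarrow> K' \<lesssim> N \<Longrightarrow> w K = w K' \<Longrightarrow> K = K'" for I w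
    using that unfolding good_def by blast
  have "(N \<times> N) <+> N \<lesssim> N <+> N"
    by (simp add: assms sum_lepoll_mono times_self_lepoll)
  then have "(N \<times> N) <+> N \<lesssim> N"
    using sum_self_lepoll[OF assms] by (rule lepoll_trans)
  then obtain h where h: "inj_on h ((N \<times> N) <+> N)" "h ` ((N \<times> N) <+> N) \<subseteq> N"
    by (auto simp: lepoll_def)
  \<comment> \<open>Packs a binary relation on \<open>N\<close> and a subset of \<open>N\<close>
    into one subset of \<open>N\<close>.\<close>
  define code where "code P Q = h ` (Inl ` P \<union> Inr ` Q)" for P Q
  have code_sub: "code P Q \<subseteq> N" if "P \<subseteq> N \<times> N" "Q \<subseteq> N" for P Q
    using h(2) that unfolding code_def by blast
  have code_eq: "P = P' \<and> Q = Q'"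
    if "code P Q = code P' Q'" "P \<subseteq> N \<times> N" "Q \<subseteq> N" "P' \<subseteq> N \<times> N" "Q' \<subseteq> N" for P Q P' Q'
  proof -
    have "Inl ` P \<union> Inr ` Q \<subseteq> (N \<times> N) <+> N" "Inl ` P' \<union> Inr ` Q' \<subseteq> (N \<times> N) <+> N"
      using that by auto
    then have "Inl ` P \<union> Inr ` Q = Inl ` P' \<union> Inr ` Q'"
      using that(1) h(1) unfolding code_def by (metis inj_on_image_eq_iff)
    then show ?thesis by auto
  qed
  have step: "\<exists>w. good I w" if IH: "\<And>x. x \<in> I \<Longrightarrow> \<exists>w. good (seg x) w" for I
  proof -
    obtain W where W: "\<And>x. x \<in> I \<Longrightarrow> good (seg x) (W x)" using IH by metis
    show ?thesis
    proof (cases "\<exists>Z\<subseteq>I. Z \<lesssim> N \<and> (\<forall>x\<in>I. \<exists>z\<in>Z. x = z \<or> (x, z) \<in> lt)")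
      case True
      then obtain Z where Z: "Z \<subseteq> I" "Z \<lesssim> N" "\<And>x. x \<in> I \<Longrightarrow> \<exists>z\<in>Z. x = z \<or> (x, z) \<in> lt" by blast
      obtain g where g: "inj_on g Z" "g ` Z \<subseteq> N" using Z(2) by (auto simp: lepoll_def)
      \<comment> \<open>\<open>Z\<close> is cofinal in \<open>I\<close> and has at most
        \<open>|N|\<close> elements. The colour of \<open>K\<close> records the colour of the part
        of \<open>K\<close> below each \<open>z\<close> in \<open>Z\<close>, and the trace of
        \<open>K\<close> on \<open>Z\<close>.\<close>
      define P where "P K = {(g z, a) |z a. z \<in> Z \<and> a \<in> W z (K \<inter> seg z)}" for K
      define w where "w K = code (P K) (g ` (K \<inter> Z))" for K
      have WN: "W z K \<subseteq> N" if "z \<in> Z" for z K using W Z(1) that unfolding good_def by blast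
      have P: "P K \<subseteq> N \<times> N" for K using g WN unfolding P_def by blast
      have gN: "g ` (K \<inter> Z) \<subseteq> N" for K using g by blast
      have "K = K'" if K: "K \<subseteq> K'" "K' \<subseteq> I" "K' \<lesssim> N" "w K = w K'" for K K'
      proof -
        have PP: "P K = P K'" and "g ` (K \<inter> Z) = g ` (K' \<inter> Z)"
          using code_eq[OF K(4)[unfolded w_def] P gN P gN] by auto
        then have KZ: "K \<inter> Z = K' \<inter> Z" using g(1) by (simp add: inj_on_image_eq_iff)
        have "K \<inter> seg z = K' \<inter> seg z" if z: "z \<in> Z" for z
        proof -
          have "W z (K \<inter> seg z) = P K `` {g z}" for K
            using g(1) z unfolding P_def by (auto dest: inj_onD)
          then have "W z (K \<inter> seg z) = W z (K' \<inter> seg z)" using PP by simp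
          moreover have "K' \<inter> seg z \<lesssim> N" using K(3) by (meson Int_lower1 lepoll_trans subset_imp_lepoll)
          ultimately show ?thesis
            using Z(1) z K(1) by (intro goodD[OF W[of z]]) auto
        qed
        moreover have "\<exists>z\<in>Z. x = z \<or> x \<in> seg z" if "x \<in> K'" for x
          using Z(3) K(2) that by (auto simp: seg_def)
        ultimately show ?thesis using K(1) KZ by blast
      qed
      moreover have "w K \<subseteq> N" for K unfolding w_def by (rule code_sub[OF P gN])
      ultimately have "good I w" by (intro goodI)
      then show ?thesis by blast
    next
      case False
      \<comment> \<open>Without a cofinal set of size at most \<open>|N|\<close>, every
        \<open>K\<close> of that size is strictly bounded in \<open>I\<close>.\<close>
      have bdd: "\<exists>x\<in>I. K \<subseteq> seg x" if "K \<subseteq> I" "K \<lesssim> N" for K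
      proof -
        have "\<not> (\<forall>x\<in>I. \<exists>z\<in>K. x = z \<or> (x, z) \<in> lt)" using False that by auto
        then obtain x where x: "x \<in> I" "\<And>z. z \<in> K \<Longrightarrow> x \<noteq> z \<and> (x, z) \<notin> lt" by auto
        have "z \<in> seg x" if "z \<in> K" for z
          using total[of z x] x(2)[OF that] by (auto simp: seg_def)
        then show ?thesis using x(1) by auto
      qed
      \<comment> \<open>\<open>SOME\<close> sees \<open>K\<close> only through its strict upper
        bounds, so sets with the same bounds share the same \<open>b\<close>.\<close>
      define b where "b K = (SOME x. x \<in> I \<and> K \<subseteq> seg x)" for K
      have b: "b K \<in> I \<and> K \<subseteq> seg (b K)" if "K \<subseteq> I" "K \<lesssim> N" for K
      proof -
        have "\<exists>x. x \<in> I \<and> K \<subseteq> seg x" using bdd[OF that] by blast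
        then show ?thesis unfolding b_def by (rule someI_ex)
      qed
      define g where "g K = (SOME f. inj_on f K \<and> f ` K \<subseteq> N)" for K :: "'s set"
      have g: "inj_on (g K) K \<and> g K ` K \<subseteq> N" if "K \<lesssim> N" for K
        using that unfolding g_def lepoll_def by (rule someI_ex)
      \<comment> \<open>A copy on \<open>N\<close> of the order of \<open>K\<close>; its reflexive
        pairs recover the image of \<open>g K\<close>.\<close>
      define P where "P K = {(g K x, g K y) |x y. x \<in> K \<and> y \<in> K \<and> (x = y \<or> (x, y) \<in> lt)}" for K
      define w where "w K = (if K \<subseteq> I \<and> K \<lesssim> N then code (P K) (W (b K) K) else {})" for K
      have P: "P K \<subseteq> N \<times> N" if "K \<lesssim> N" for K using g[OF that] unfolding P_def by blast
      have WN: "W (b K) K \<subseteq> N" if "K \<subseteq> I" "K \<lesssim> N" for K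
        using W b[OF that] unfolding good_def by blast
      have "K = K'" if K: "K \<subseteq> K'" "K' \<subseteq> I" "K' \<lesssim> N" "w K = w K'" for K K'
      proof -
        have K': "K \<subseteq> I" "K \<lesssim> N" using K(1-3) lepoll_trans[OF subset_imp_lepoll[OF K(1)]] by auto
        then have "code (P K) (W (b K) K) = code (P K') (W (b K') K')" using K unfolding w_def by simp
        note eqs = code_eq[OF this P[OF K'(2)] WN[OF K'] P[OF K(3)] WN[OF K(2,3)]]
        then have PP: "P K = P K'" and WW: "W (b K) K = W (b K') K'" by auto
        have "\<exists>x'\<in>K. g K x' = g K' x" if "x \<in> K'" for x
        proof -
          have "(g K' x, g K' x) \<in> P K" unfolding PP using that by (auto simp: P_def)
          then show ?thesis by (auto simp: P_def)
        qed
        \<comment> \<open>Equality of the copies makes \<open>t\<close>, the inverse of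
          \<open>g K\<close> after \<open>g K'\<close>, an order-preserving map of \<open>K'\<close>
          into its subset \<open>K\<close>.\<close>
        then obtain t where t: "\<And>x. x \<in> K' \<Longrightarrow> t x \<in> K \<and> g K (t x) = g K' x" by metis
        have t_mono: "(t x, t y) \<in> lt" if "x \<in> K'" "y \<in> K'" "(x, y) \<in> lt" for x y
        proof -
          have "(g K' x, g K' y) \<in> P K" unfolding PP using that by (auto simp: P_def)
          then obtain x' y' where *: "x' \<in> K" "y' \<in> K" "x' = y' \<or> (x', y') \<in> lt"
            "g K x' = g K' x" "g K y' = g K' y" by (auto simp: P_def)
          then have "x' = t x" "y' = t y" using t that g[OF K'(2)] by (metis inj_onD)+
          moreover have "x \<noteq> y" using wf that(3) by auto
          then have "t x \<noteq> t y" using t that g[OF K(3)] by (metis inj_onD)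
          ultimately show ?thesis using * by auto
        qed
        \<comment> \<open>An order-preserving map of a well-ordered set into itself moves no point
          down: below such an \<open>x\<close>, the point \<open>t x\<close> would be another one.
          Hence \<open>K\<close> is cofinal in \<open>K'\<close>.\<close>
        have t_ge: "(t x, x) \<notin> lt" if "x \<in> K'" for x
          using wf that
        proof (induction x rule: wf_induct_rule)
          case (less x)
          then show ?case using t_mono[of "t x" x] t K(1) by blast
        qed
        have "K \<subseteq> seg x \<longleftrightarrow> K' \<subseteq> seg x" for x
        proof
          assume *: "K \<subseteq> seg x"
          show "K' \<subseteq> seg x"
          proof
            fix y assume y: "y \<in> K'"
            then have "(t y, x) \<in> lt" "y = t y \<or> (y, t y) \<in> lt"
              using t_ge[OF y] t[OF y] * total[of y "t y"] by (auto simp: seg_def)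
            then show "y \<in> seg x" using trans unfolding seg_def by (auto dest: transD)
          qed
        qed (use K(1) in blast)
        then have "b K = b K'" unfolding b_def by simp
        then show ?thesis
          using b[OF K(2,3)] WW K by (intro goodD[OF W[of "b K'"]]) auto
      qed
      moreover have "w K \<subseteq> N" for K using code_sub[OF P WN] unfolding w_def by auto
      ultimately have "good I w" by (intro goodI)
      then show ?thesis by blast
    qed
  qed
  have "\<exists>w. good (seg x) w" for x
    using wf by (induction x rule: wf_induct_rule) (rule step, auto simp: seg_def)
  then have "\<exists>w. good UNIV w" by (rule step)
  then show ?thesis unfolding good_def by simp
qed

lemma lepoll_finite: "A \<lesssim> B \<Longrightarrow> finite B \<Longrightarrow> finite A"
  by (meson finite_imageD finite_subset lepoll_def)

text \<open>Among all pairs of a set \<open>C\<close> below \<open>A\<close> and a family dense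
  below \<open>C\<close>, take one whose family has least size. No smaller family can then be dense
  below any \<open>C'\<close> inside \<open>C\<close>. The order \<open>P\<close> is kept abstract:
  it is used for the non-empty regular open sets and for the big ones.\<close>

lemma exists_homogeneous_density:
  assumes "A \<in> P"
  obtains C D where "C \<in> P" "C \<subseteq> A" "\<forall>d\<in>D. d \<in> P \<and> d \<subseteq> C"
    "\<forall>u\<in>P. u \<subseteq> C \<longrightarrow> (\<exists>d\<in>D. d \<subseteq> u)"
    "\<forall>C'\<in>P. C' \<subseteq> C \<longrightarrow> (\<forall>E\<subseteq>P. \<not> D \<lesssim> E \<longrightarrow> (\<exists>u\<in>P. u \<subseteq> C' \<and> (\<forall>e\<in>E. \<not> e \<subseteq> u)))"
proof -
  define S where "S = {(C, E). C \<in> P \<and> C \<subseteq> A \<and> E \<subseteq> P \<and> (\<forall>u\<in>P. u \<subseteq> C \<longrightarrow> (\<exists>e\<in>E. e \<subseteq> u))}"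
  have "(A, P) \<in> S" using assms unfolding S_def by auto
  then have "S \<noteq> {}" by blast
  then obtain q where "q \<in> S" and qmin: "\<forall>q'\<in>S. snd q \<lesssim> snd q'"
    using exists_lepoll_minimal[of S snd] by blast
  then obtain C E where CE: "(C, E) \<in> S" and min: "\<And>C' E'. (C', E') \<in> S \<Longrightarrow> E \<lesssim> E'"
    by (cases q) fastforce
  define D where "D = {d \<in> E. d \<subseteq> C}"
  have "D \<lesssim> E" unfolding D_def by (intro subset_imp_lepoll) auto
  have "\<exists>u\<in>P. u \<subseteq> C' \<and> (\<forall>e\<in>E'. \<not> e \<subseteq> u)" if "C' \<in> P" "C' \<subseteq> C" "E' \<subseteq> P" "\<not> D \<lesssim> E'" for C' E'
  proof (rule ccontr)
    assume "\<not> ?thesis"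
    then have "(C', E') \<in> S" using that CE unfolding S_def by auto
    then show False using min lepoll_trans[OF \<open>D \<lesssim> E\<close>] that(4) by blast
  qed
  moreover have "C \<in> P" "C \<subseteq> A" "\<forall>d\<in>D. d \<in> P \<and> d \<subseteq> C"
    using CE unfolding S_def D_def by auto
  moreover have "\<exists>d\<in>D. d \<subseteq> u" if u: "u \<in> P" "u \<subseteq> C" for u
  proof -
    obtain e where "e \<in> E" "e \<subseteq> u" using CE u unfolding S_def by blast
    then show ?thesis using u(2) unfolding D_def by (intro bexI[of _ e]) auto
  qed
  ultimately show ?thesis by (intro that[of C D]) auto
qed

text \<open>Transfinite recursion along \<open>card_less D\<close>: the sets \<open>h (d y)\<close>
  of the earlier stages are fewer than \<open>D\<close>, so by \<open>sparse\<close> they are not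
  dense below \<open>a x\<close>.\<close>

lemma left_separated_choice:
  assumes sparse: "\<forall>C'\<in>P. C' \<subseteq> C \<longrightarrow> (\<forall>E\<subseteq>P. \<not> D \<lesssim> E \<longrightarrow> (\<exists>u\<in>P. u \<subseteq> C' \<and> (\<forall>e\<in>E. \<not> e \<subseteq> u)))"
    and a: "\<And>x. x \<in> D \<Longrightarrow> a x \<in> P \<and> a x \<subseteq> C"
    and h: "\<And>u. u \<in> P \<Longrightarrow> h u \<in> P"
  shows "\<exists>d. \<forall>x\<in>D. d x \<in> P \<and> d x \<subseteq> a x \<and> (\<forall>y. (y, x) \<in> card_less D \<longrightarrow> \<not> h (d y) \<subseteq> d x)"
proof -
  let ?Q = "\<lambda>f x r. x \<in> D \<longrightarrow> r \<in> P \<and> r \<subseteq> a x \<and> (\<forall>y. (y, x) \<in> card_less D \<longrightarrow> \<not> h (f y) \<subseteq> r)"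
  have "\<exists>d. \<forall>x. ?Q d x (d x)"
  proof (rule dependent_wf_choice[OF wf_card_less[of D]])
    fix f x
    assume IH: "\<And>y. (y, x) \<in> card_less D \<Longrightarrow> ?Q f y (f y)"
    show "\<exists>r. ?Q f x r"
    proof (cases "x \<in> D")
      case True
      define E where "E = (\<lambda>y. h (f y)) ` {y. (y, x) \<in> card_less D}"
      have "E \<subseteq> P" using IH h unfolding E_def by (auto dest: card_less_in)
      moreover have "\<not> D \<lesssim> E"
        using segment_card_less[OF True] lepoll_trans[OF _ image_lepoll] unfolding E_def by blast
      ultimately obtain u where "u \<in> P" "u \<subseteq> a x" "\<forall>e\<in>E. \<not> e \<subseteq> u"
        using bspec[OF sparse, of "a x"] a[OF True] by blast
      then show ?thesis unfolding E_def by blast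
    qed auto
  qed auto
  then show ?thesis by blast
qed

section \<open>Regular open sets\<close>

context
  fixes X :: "'a topology"
begin

definition reg :: "'a set \<Rightarrow> 'a set" where
  "reg A = X interior_of (X closure_of A)"

definition regs :: "'a set set" where
  "regs = {A. regular_open_in X A}"

text \<open>For regular open \<open>A\<close> the size of \<open>down A\<close> is the number of
  regular open subsets of the subspace \<open>A\<close>; the lemmas \<open>RO_lepoll_down\<close>
  and \<open>down_reg_lepoll_RO\<close> connect the two counts, and all later counting is done with
  \<open>down\<close>.\<close>

definition down :: "'a set \<Rightarrow> 'a set set" where
  "down A = {B \<in> regs. B \<subseteq> A}"

lemma regs_iff: "A \<in> regs \<longleftrightarrow> reg A = A"
  by (simp add: regs_def reg_def regular_open_in_def)

lemma openin_reg [simp]: "openin X (reg A)"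
  by (simp add: reg_def)

lemma regs_open: "A \<in> regs \<Longrightarrow> openin X A"
  by (metis openin_reg regs_iff)

lemma reg_mono: "A \<subseteq> B \<Longrightarrow> reg A \<subseteq> reg B"
  by (simp add: reg_def closure_of_mono interior_of_mono)

lemma subset_reg: "openin X A \<Longrightarrow> A \<subseteq> reg A"
  by (simp add: reg_def closure_of_subset interior_of_maximal openin_subset)

lemma reg_subset_closure: "reg A \<subseteq> X closure_of A"
  by (simp add: reg_def interior_of_subset)

lemma reg_in_regs [simp]: "reg A \<in> regs"
proof -
  have "X closure_of (reg A) \<subseteq> X closure_of A"
    by (metis closure_of_closure_of closure_of_mono reg_subset_closure)
  then have "reg (reg A) \<subseteq> reg A"
    by (simp add: reg_def interior_of_mono)
  then show ?thesis by (simp add: regs_iff subset_reg subset_antisym)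
qed

lemma reg_minimal: "A \<subseteq> B \<Longrightarrow> B \<in> regs \<Longrightarrow> reg A \<subseteq> B"
  by (metis reg_mono regs_iff)

lemma reg_maximal: "openin X A \<Longrightarrow> A \<subseteq> X closure_of B \<Longrightarrow> A \<subseteq> reg B"
  by (simp add: reg_def interior_of_maximal)

lemma empty_in_regs [simp]: "{} \<in> regs"
  by (simp add: regs_iff reg_def)

lemma regsI: "openin X A \<Longrightarrow> reg A \<subseteq> A \<Longrightarrow> A \<in> regs"
  by (simp add: regs_iff subset_antisym subset_reg)

lemma regs_Int: "A \<in> regs \<Longrightarrow> B \<in> regs \<Longrightarrow> A \<inter> B \<in> regs"
  by (rule regsI) (simp_all add: openin_Int regs_open reg_minimal)

text \<open>The relative complement in the Boolean algebra of regular open sets. Complementation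
  exchanges interior and closure, and the closure of \<open>B\<close> lies in that of
  \<open>reg B\<close>.\<close>

lemma regs_diff: "A \<in> regs \<Longrightarrow> openin X B \<Longrightarrow> A - X closure_of B \<in> regs"
proof -
  assume A: "A \<in> regs" and B: "openin X B"
  have "topspace X - X closure_of B \<in> regs"
  proof (rule regsI)
    have "reg (topspace X - X closure_of B) = topspace X - X closure_of (reg B)"
      by (simp add: reg_def closure_of_complement interior_of_complement)
    then show "reg (topspace X - X closure_of B) \<subseteq> topspace X - X closure_of B"
      using closure_of_mono[OF subset_reg[OF B], of X] by blast
  qed (simp add: openin_diff)
  then have "A \<inter> (topspace X - X closure_of B) \<in> regs"
    using A regs_Int by blast
  moreover have "A \<inter> (topspace X - X closure_of B) = A - X closure_of B"
    using openin_subset[OF regs_open[OF A]] by blast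
  ultimately show ?thesis by simp
qed

lemma regs_diff_nonempty: "A \<in> regs \<Longrightarrow> B \<in> regs \<Longrightarrow> \<not> A \<subseteq> B \<Longrightarrow> A - X closure_of B \<noteq> {}"
  using reg_maximal[OF regs_open] by (metis Diff_eq_empty_iff regs_iff)

lemma Int_closure_empty: "openin X A \<Longrightarrow> A \<inter> B = {} \<Longrightarrow> A \<inter> X closure_of B = {}"
  by (simp add: openin_Int_closure_of_eq_empty)

lemma diff_closure_disjoint: "openin X B \<Longrightarrow> (A - X closure_of B) \<inter> B = {}"
  using closure_of_subset[OF openin_subset] by blast

text \<open>Pieces prescribed in disjoint open cells can be read off from their join: within the
  open set \<open>z t\<close>, the closure of the union stays in the closure of \<open>f t\<close>,
  and \<open>f t\<close> is regular open. All encodings rest on this.\<close>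

lemma reg_UN_Int:
  assumes z: "disjoint_family_on z I" "\<And>t. t \<in> I \<Longrightarrow> openin X (z t)"
    and f: "\<And>t. t \<in> I \<Longrightarrow> f t \<subseteq> z t" "\<And>t. t \<in> I \<Longrightarrow> f t \<in> regs" and t: "t \<in> I"
  shows "reg (\<Union>t\<in>I. f t) \<inter> z t = f t"
proof
  have "z t \<inter> (\<Union>t\<in>I. f t) = f t"
  proof (intro equalityI subsetI)
    fix x assume "x \<in> z t \<inter> (\<Union>t\<in>I. f t)"
    then obtain s where s: "s \<in> I" "x \<in> f s" "x \<in> z t" by auto
    then have "s = t" using f(1)[OF s(1)] disjoint_family_onD[OF z(1) s(1) t] by auto
    then show "x \<in> f t" using s by simp
  qed (use f(1)[OF t] t in auto)
  then have "z t \<inter> X closure_of (\<Union>t\<in>I. f t) \<subseteq> X closure_of (f t)"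
    using openin_Int_closure_of_subset[OF z(2)[OF t], of "\<Union>t\<in>I. f t"] by simp
  then have "reg (\<Union>t\<in>I. f t) \<inter> z t \<subseteq> X closure_of (f t)"
    using reg_subset_closure by blast
  then have "reg (\<Union>t\<in>I. f t) \<inter> z t \<subseteq> reg (f t)"
    by (intro reg_maximal) (use z(2) t in auto)
  then show "reg (\<Union>t\<in>I. f t) \<inter> z t \<subseteq> f t"
    using f(2) t regs_iff by simp
  have "f t \<subseteq> (\<Union>t\<in>I. f t)" using t by blast
  also have "\<dots> \<subseteq> reg (\<Union>t\<in>I. f t)"
    using f(2) by (intro subset_reg) (auto intro: regs_open)
  finally show "f t \<subseteq> reg (\<Union>t\<in>I. f t) \<inter> z t" using f(1) t by blast
qed

text \<open>The part of \<open>u\<close> inside the cells is dense in \<open>u\<close>, so the open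
  set \<open>u\<close> lies in the closure of \<open>u'\<close> and hence in \<open>u'\<close>. Thus
  a regular open set is determined by its traces on a dense family of cells.\<close>

lemma subset_by_pieces:
  assumes u: "openin X u" "u \<subseteq> X closure_of (\<Union>t\<in>I. z t)" and u': "u' \<in> regs"
    and le: "\<And>t. t \<in> I \<Longrightarrow> u \<inter> z t \<subseteq> u'"
  shows "u \<subseteq> u'"
proof -
  have "u \<subseteq> u \<inter> X closure_of (\<Union>t\<in>I. z t)" using u by blast
  also have "\<dots> \<subseteq> X closure_of (u \<inter> (\<Union>t\<in>I. z t))"
    by (rule openin_Int_closure_of_subset[OF u(1)])
  also have "\<dots> \<subseteq> X closure_of u'"
    using le by (intro closure_of_mono) blast
  finally have "u \<subseteq> reg u'" by (rule reg_maximal[OF u(1)])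
  then show ?thesis using u' by (simp add: regs_iff)
qed

text \<open>The part of \<open>A\<close> outside the closure of the cells is regular open and misses
  every cell, so maximality makes it empty.\<close>

lemma subset_closure_UN:
  assumes A: "A \<in> regs" and z: "\<And>t. t \<in> I \<Longrightarrow> openin X (z t)"
    and max: "\<And>u. u \<in> regs \<Longrightarrow> u \<subseteq> A \<Longrightarrow> (\<And>t. t \<in> I \<Longrightarrow> z t \<inter> u = {}) \<Longrightarrow> u = {}"
  shows "A \<subseteq> X closure_of (\<Union>t\<in>I. z t)"
proof -
  have op: "openin X (\<Union>t\<in>I. z t)" using z by blast
  have "A - X closure_of (\<Union>t\<in>I. z t) = {}"
  proof (rule max)
    show "z t \<inter> (A - X closure_of (\<Union>t\<in>I. z t)) = {}" if "t \<in> I" for t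
      using diff_closure_disjoint[OF op, of A] that by auto
  qed (auto simp: regs_diff A op)
  then show ?thesis by blast
qed

section \<open>Counting regular open subsets\<close>

lemma down_iff [simp]: "B \<in> down A \<longleftrightarrow> B \<in> regs \<and> B \<subseteq> A"
  by (simp add: down_def)

lemma down_mono: "A \<subseteq> B \<Longrightarrow> down A \<lesssim> down B"
  by (intro subset_imp_lepoll) (auto simp: down_def)

lemma RO_eq:
  assumes G: "openin X G"
  shows "RO X G = {A. A = G \<inter> reg (G \<inter> A)}"
proof -
  have *: "subtopology X G interior_of (subtopology X G closure_of A) = G \<inter> reg (G \<inter> A)" for A
  proof -
    have "subtopology X G interior_of (subtopology X G closure_of A)
        = G \<inter> X interior_of (G \<inter> X closure_of (G \<inter> A))"
      by (simp add: interior_of_subtopology_open[OF G] closure_of_subtopology)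
    also have "\<dots> = G \<inter> reg (G \<inter> A)"
      by (simp add: interior_of_Int interior_of_openin[OF G] reg_def)
    finally show ?thesis .
  qed
  show ?thesis
    unfolding RO_def regular_open_in_def * by auto
qed

lemma RO_lepoll_down:
  assumes U: "U \<in> regs"
  shows "RO X U \<lesssim> down U"
proof -
  have "A \<in> down U" if "A \<in> RO X U" for A
    using that U by (auto simp: RO_eq[OF regs_open[OF U]] intro: regs_Int) (metis Int_absorb1 Int_lower1 U reg_in_regs regs_Int)
  then show ?thesis by (intro subset_imp_lepoll) blast
qed

text \<open>\<open>G\<close> is dense in \<open>reg G\<close>, so a regular open subset of
  \<open>reg G\<close> is determined by its trace on \<open>G\<close>. This is
  \<open>subset_by_pieces\<close> with the single cell \<open>G\<close>.\<close>

lemma down_reg_lepoll_RO: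
  assumes G: "openin X G"
  shows "down (reg G) \<lesssim> RO X G"
proof -
  have cl: "A \<subseteq> X closure_of (\<Union>t\<in>{()}. G)" if "A \<in> down (reg G)" for A
    using that reg_subset_closure by auto
  have "inj_on (\<lambda>A. G \<inter> A) (down (reg G))"
  proof (rule inj_onI)
    fix A B assume *: "A \<in> down (reg G)" "B \<in> down (reg G)" "G \<inter> A = G \<inter> B"
    then show "A = B"
      using subset_by_pieces[OF _ cl[OF *(1)], of B] subset_by_pieces[OF _ cl[OF *(2)], of A]
      by (metis IntD2 Int_commute down_iff inf_le2 regs_open subset_antisym)
  qed
  moreover have "G \<inter> A \<in> RO X G" if A: "A \<in> down (reg G)" for A
  proof -
    have "reg (G \<inter> A) \<subseteq> A"
      using A by (intro reg_minimal) auto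
    moreover have "G \<inter> A \<subseteq> reg (G \<inter> A)"
      using A G by (intro subset_reg) (auto intro: regs_open)
    ultimately show ?thesis by (auto simp: RO_eq[OF G] Int_assoc[symmetric])
  qed
  ultimately show ?thesis unfolding lepoll_def by blast
qed

section \<open>Antichains of full cardinality\<close>

text \<open>An inclusion antichain inside \<open>B\<close> indexed by \<open>down A\<close>. Two
  sets are kept apart because an atom \<open>A\<close> contains no antichain of the size of
  \<open>down A\<close>.\<close>

definition antichain_embedding where
  "antichain_embedding A B T \<longleftrightarrow> (\<forall>u\<in>down A. T u \<in> down B) \<and>
     (\<forall>u\<in>down A. \<forall>v\<in>down A. T u \<subseteq> T v \<longrightarrow> u = v)"

definition homogeneous where
  "homogeneous V \<longleftrightarrow> V \<in> regs \<and> V \<noteq> {} \<and> (\<forall>u\<in>regs. u \<noteq> {} \<longrightarrow> u \<subseteq> V \<longrightarrow> down V \<lesssim> down u)"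

text \<open>For regular open \<open>V\<close>: an atom of the algebra of regular open sets, or the
  empty set.\<close>

definition atomic where
  "atomic V \<longleftrightarrow> (\<forall>u\<in>regs. u \<subseteq> V \<longrightarrow> u = {} \<or> u = V)"

lemma reg_in_down: "W \<subseteq> A \<Longrightarrow> A \<in> regs \<Longrightarrow> reg W \<in> down A"
  by (simp add: reg_minimal)

lemma exists_homogeneous:
  assumes "A \<in> regs" "A \<noteq> {}"
  shows "\<exists>V\<subseteq>A. homogeneous V"
proof -
  have "A \<in> {u \<in> regs. u \<noteq> {} \<and> u \<subseteq> A}" using assms by auto
  then obtain V where "V \<in> {u \<in> regs. u \<noteq> {} \<and> u \<subseteq> A}"
    "\<forall>u\<in>{u \<in> regs. u \<noteq> {} \<and> u \<subseteq> A}. down V \<lesssim> down u"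
    using exists_lepoll_minimal[of "{u \<in> regs. u \<noteq> {} \<and> u \<subseteq> A}" down] by blast
  then show ?thesis unfolding homogeneous_def by blast
qed

lemma homogeneous_subset:
  assumes "homogeneous V" "u \<in> regs" "u \<noteq> {}" "u \<subseteq> V"
  shows "homogeneous u"
proof -
  have "down u \<lesssim> down w" if "w \<in> regs" "w \<noteq> {}" "w \<subseteq> u" for w
  proof -
    have "down V \<lesssim> down w" using assms that unfolding homogeneous_def by auto
    then show ?thesis by (rule lepoll_trans[OF down_mono[OF assms(4)]])
  qed
  then show ?thesis using assms unfolding homogeneous_def by blast
qed

text \<open>An atom has at most two regular open subsets, so homogeneity would leave
  \<open>V\<close> with at most two, while a non-atomic \<open>V\<close> has three.\<close>

lemma not_atomic_subset:
  assumes V: "homogeneous V" "\<not> atomic V" and u: "u \<in> regs" "u \<noteq> {}" "u \<subseteq> V"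
  shows "\<not> atomic u"
proof
  assume "atomic u"
  then have "down u \<subseteq> {{}, u}" unfolding atomic_def by auto
  then have fin: "finite (down u)" and "card (down u) \<le> card {{}, u}"
    by (auto intro: finite_subset card_mono)
  then have card2: "card (down u) \<le> 2"
    using card_insert_le_m1[of 2 "{u}" "{}"] by simp
  have "down V \<lesssim> down u" using V u unfolding homogeneous_def by blast
  then have finV: "finite (down V)" and "card (down V) \<le> 2"
    using fin card2 lepoll_finite[of "down V" "down u"] lepoll_iff_card_le[of "down V" "down u"]
    by auto
  obtain v where v: "v \<in> regs" "v \<subseteq> V" "v \<noteq> {}" "v \<noteq> V"
    using V(2) unfolding atomic_def by auto
  have "V \<in> regs" "V \<noteq> {}" using V unfolding homogeneous_def by auto
  then have "card {{}, v, V} \<le> card (down V)"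
    using v by (intro card_mono finV) auto
  moreover have "card {{}, v, V} = 3" using v \<open>V \<noteq> {}\<close> by auto
  ultimately show False using \<open>card (down V) \<le> 2\<close> by simp
qed

lemma split_not_atomic:
  assumes "u \<in> regs" "\<not> atomic u"
  shows "\<exists>x\<in>regs. \<exists>y\<in>regs. x \<noteq> {} \<and> y \<noteq> {} \<and> x \<subseteq> u \<and> y \<subseteq> u \<and> x \<inter> y = {}"
proof -
  obtain x where x: "x \<in> regs" "x \<subseteq> u" "x \<noteq> {}" "x \<noteq> u"
    using assms unfolding atomic_def by auto
  then have "\<not> u \<subseteq> x" by auto
  let ?y = "u - X closure_of x"
  have "?y \<in> regs" "?y \<noteq> {}" "x \<inter> ?y = {}"
    using regs_diff[OF assms(1) regs_open[OF x(1)]] regs_diff_nonempty[OF assms(1) x(1) \<open>\<not> u \<subseteq> x\<close>]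
      diff_closure_disjoint[OF regs_open[OF x(1)], of u] by auto
  then show ?thesis using x by (intro bexI[of _ x] bexI[of _ ?y]) auto
qed

lemma reg_Un_Int:
  assumes "x \<in> regs" "y \<in> regs" "x \<inter> y = {}" "p \<in> down x" "q \<in> down y"
  shows "reg (p \<union> q) \<inter> x = p" "reg (p \<union> q) \<inter> y = q"
proof -
  define z where "z b = (if b then x else y)" for b
  define f where "f b = (if b then p else q)" for b
  have eq: "(\<Union>b\<in>UNIV. f b) = p \<union> q" unfolding f_def UNIV_bool by auto
  have "reg (\<Union>b\<in>UNIV. f b) \<inter> z b = f b" for b
    using assms by (intro reg_UN_Int) (auto simp: z_def f_def disjoint_family_on_def regs_open)
  from this[of True] this[of False] show "reg (p \<union> q) \<inter> x = p" "reg (p \<union> q) \<inter> y = q"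
    unfolding eq by (simp_all add: z_def f_def)
qed

text \<open>In a left-separated family no earlier set lies in a later one. Joining such a family inside \<open>x\<close>
  with the complements, inside \<open>y\<close>, of a second one excludes both directions.\<close>
lemma exists_separated_antichain:
  fixes D :: "'a set set"
  assumes sparse: "\<forall>C'\<in>regs - {{}}. C' \<subseteq> C \<longrightarrow> (\<forall>E\<subseteq>regs - {{}}. \<not> D \<lesssim> E \<longrightarrow>
      (\<exists>u\<in>regs - {{}}. u \<subseteq> C' \<and> (\<forall>e\<in>E. \<not> e \<subseteq> u)))"
    and u: "u \<in> regs" "u \<subseteq> C" "\<not> atomic u"
  shows "\<exists>t. (\<forall>d\<in>D. t d \<in> down u) \<and> (\<forall>d\<in>D. \<forall>d'\<in>D. t d \<subseteq> t d' \<longrightarrow> d = d')"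
proof -
  obtain x y where xy: "x \<in> regs" "y \<in> regs" "x \<noteq> {}" "y \<noteq> {}" "x \<subseteq> u" "y \<subseteq> u" "x \<inter> y = {}"
    using split_not_atomic[OF u(1,3)] by auto
  have "\<exists>d. \<forall>k\<in>D. d k \<in> regs - {{}} \<and> d k \<subseteq> v \<and> (\<forall>j. (j, k) \<in> card_less D \<longrightarrow> \<not> d j \<subseteq> d k)"
    if "v \<in> regs - {{}}" "v \<subseteq> u" for v
    using left_separated_choice[OF sparse, where a = "\<lambda>_. v" and h = "\<lambda>u. u"] that u(2) by auto
  from this[of x] this[of y] xy obtain f g where
    f0: "\<forall>k\<in>D. f k \<in> regs - {{}} \<and> f k \<subseteq> x \<and> (\<forall>j. (j, k) \<in> card_less D \<longrightarrow> \<not> f j \<subseteq> f k)" and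
    g0: "\<forall>k\<in>D. g k \<in> regs - {{}} \<and> g k \<subseteq> y \<and> (\<forall>j. (j, k) \<in> card_less D \<longrightarrow> \<not> g j \<subseteq> g k)"
    by blast
  have f: "\<And>k. k \<in> D \<Longrightarrow> f k \<in> down x" "\<And>j k. k \<in> D \<Longrightarrow> (j, k) \<in> card_less D \<Longrightarrow> \<not> f j \<subseteq> f k"
    using f0 by auto
  have g: "\<And>k. k \<in> D \<Longrightarrow> g k \<in> down y" "\<And>j k. k \<in> D \<Longrightarrow> (j, k) \<in> card_less D \<Longrightarrow> \<not> g j \<subseteq> g k"
    using g0 by auto
  define q where "q k = y - X closure_of (g k)" for k
  have q: "q k \<in> down y" if "k \<in> D" for k
    using g(1)[OF that] xy(2) unfolding q_def by (auto intro: regs_diff regs_open)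
  have q_anti: "g k \<subseteq> g j" if "q j \<subseteq> q k" "j \<in> D" "k \<in> D" for j k
  proof (rule ccontr)
    assume "\<not> g k \<subseteq> g j"
    then have "g k - X closure_of (g j) \<noteq> {}"
      using regs_diff_nonempty g(1) that by auto
    moreover have "g k - X closure_of (g j) \<subseteq> q j"
      using g(1)[OF that(3)] unfolding q_def by auto
    moreover have "q k \<inter> g k = {}"
      unfolding q_def using g(1)[OF that(3)] by (intro diff_closure_disjoint) (simp add: regs_open)
    ultimately show False using that(1) by blast
  qed
  define t where "t k = reg (f k \<union> q k)" for k
  have tx: "t k \<inter> x = f k" and ty: "t k \<inter> y = q k" if "k \<in> D" for k
    using reg_Un_Int[OF xy(1,2,7) f(1)[OF that] q[OF that]] unfolding t_def by auto
  have "t k \<in> down u" if "k \<in> D" for k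
    unfolding t_def by (rule reg_in_down[OF _ u(1)]) (use f(1)[OF that] q[OF that] xy in auto)
  moreover have "j = k" if "j \<in> D" "k \<in> D" "t j \<subseteq> t k" for j k
  proof -
    have "f j \<subseteq> f k" "q j \<subseteq> q k"
      using that(1,2) Int_mono[OF that(3) order_refl, of x] Int_mono[OF that(3) order_refl, of y] tx ty
      by simp_all
    then have "(j, k) \<notin> card_less D" "(k, j) \<notin> card_less D"
      using f(2)[OF that(2), of j] g(2)[OF that(1), of k] q_anti[OF _ that(1,2)] by auto
    then show ?thesis using total_card_less[OF that(1,2)] by auto
  qed
  ultimately show ?thesis by blast
qed

text \<open>A regular open set \<open>A\<close> is determined by a maximal disjoint family \<open>M A \<subseteq> D\<close> below it, where \<open>D\<close> is
  a dense family of least cardinality. The class of \<open>|M A|\<close> is encoded in one half of \<open>V\<close>, and the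
  family itself, as a function into \<open>D\<close> on a disjoint family of the same cardinality, in the other.\<close>
lemma homogeneous_antichain_embedding:
  assumes V: "homogeneous V" "\<not> atomic V"
  shows "\<exists>T. antichain_embedding V V T"
proof -
  have VP: "V \<in> regs - {{}}" using V unfolding homogeneous_def by auto
  obtain C D where C: "C \<in> regs - {{}}" "C \<subseteq> V"
    and DP: "\<forall>d\<in>D. d \<in> regs - {{}} \<and> d \<subseteq> C"
    and denseP: "\<forall>u\<in>regs - {{}}. u \<subseteq> C \<longrightarrow> (\<exists>d\<in>D. d \<subseteq> u)"
    and sparse: "\<forall>C'\<in>regs - {{}}. C' \<subseteq> C \<longrightarrow> (\<forall>E\<subseteq>regs - {{}}. \<not> D \<lesssim> E \<longrightarrow>
      (\<exists>u\<in>regs - {{}}. u \<subseteq> C' \<and> (\<forall>e\<in>E. \<not> e \<subseteq> u)))"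
    by (rule exists_homogeneous_density[OF VP])
  have D: "d \<in> regs \<and> d \<noteq> {} \<and> d \<subseteq> C" if "d \<in> D" for d
    using DP that by auto
  have dense: "\<exists>d\<in>D. d \<subseteq> u" if "u \<in> regs" "u \<noteq> {}" "u \<subseteq> C" for u
    using denseP that by simp
  have nat: "\<not> atomic u" if "u \<in> regs" "u \<noteq> {}" "u \<subseteq> C" for u
    using not_atomic_subset[OF V that(1,2)] that(3) C(2) by blast
  \<comment> \<open>A minimal member of a finite dense family would be an atom, and there is none
    below \<open>C\<close>.\<close>
  have inf: "infinite D"
  proof
    assume fin: "finite D"
    have "D \<noteq> {}" using dense[of C] C(1) by auto
    then obtain d where d: "d \<in> D" and dmin: "\<And>d'. d' \<in> D \<Longrightarrow> d' \<subseteq> d \<Longrightarrow> d' = d"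
      using finite_has_minimal[OF fin] by blast
    obtain x y where "x \<in> regs" "y \<in> regs" "x \<noteq> {}" "y \<noteq> {}" "x \<subseteq> d" "y \<subseteq> d" "x \<inter> y = {}"
      using split_not_atomic[of d] nat D[OF d] by auto
    then show False using dense[of x] dmin D[OF d] by blast
  qed
  obtain x y where xy: "x \<in> regs" "y \<in> regs" "x \<noteq> {}" "y \<noteq> {}" "x \<subseteq> C" "y \<subseteq> C" "x \<inter> y = {}"
    using split_not_atomic[of C] nat[of C] C(1) by auto
  have "\<exists>t. (\<forall>d\<in>D. t d \<in> down u) \<and> (\<forall>d\<in>D. \<forall>d'\<in>D. t d \<subseteq> t d' \<longrightarrow> d = d')"
    if "u \<in> regs" "u \<noteq> {}" "u \<subseteq> C" for u
    using exists_separated_antichain[OF sparse, of u] that nat[OF that] by blast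
  then obtain t where t: "\<And>u d. u \<in> regs \<Longrightarrow> u \<noteq> {} \<Longrightarrow> u \<subseteq> C \<Longrightarrow> d \<in> D \<Longrightarrow> t u d \<in> down u"
    and t_inj: "\<And>u d d'. u \<in> regs \<Longrightarrow> u \<noteq> {} \<Longrightarrow> u \<subseteq> C \<Longrightarrow> d \<in> D \<Longrightarrow> d' \<in> D \<Longrightarrow> t u d \<subseteq> t u d' \<Longrightarrow> d = d'"
    by metis
  have "\<exists>I. I \<subseteq> D \<and> disjoint_family_on (\<lambda>d. d) I \<and> \<Union>I \<subseteq> A \<and> A \<subseteq> X closure_of (\<Union>I)"
    if A: "A \<in> down y" for A
  proof -
    obtain I where I: "I \<subseteq> {d\<in>D. d \<subseteq> A}" "disjoint_family_on (\<lambda>d. d) I"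
      and max: "\<forall>j\<in>{d\<in>D. d \<subseteq> A}. (\<forall>i\<in>I. i \<inter> j = {}) \<longrightarrow> j \<in> I"
      using maximal_disjoint_subfamily[of "{d\<in>D. d \<subseteq> A}" "\<lambda>d. d"] by (elim exE conjE)
    have "A \<subseteq> X closure_of (\<Union>d\<in>I. d)"
    proof (rule subset_closure_UN)
      fix u assume u: "u \<in> regs" "u \<subseteq> A" "\<And>d. d \<in> I \<Longrightarrow> d \<inter> u = {}"
      show "u = {}"
      proof (rule ccontr)
        assume "u \<noteq> {}"
        moreover have "u \<subseteq> C" using u(2) A xy(6) by auto
        ultimately obtain d where d: "d \<in> D" "d \<subseteq> u" using dense[OF u(1)] by auto
        then have "\<forall>i\<in>I. i \<inter> d = {}" using u(3) by blast
        then have "d \<in> I" using d u(2) max by auto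
        from u(3)[OF this] show False using d(2) D[OF d(1)] by auto
      qed
    next
      fix d assume "d \<in> I"
      then show "openin X d" using I(1) D[of d] by (auto intro: regs_open)
    qed (use A in auto)
    then show ?thesis using I by (intro exI[of _ I]) auto
  qed
  then have "\<forall>A\<in>down y. \<exists>I. I \<subseteq> D \<and> disjoint_family_on (\<lambda>d. d) I \<and> \<Union>I \<subseteq> A \<and> A \<subseteq> X closure_of (\<Union>I)"
    by (rule ballI)
  from bchoice[OF this] obtain M where M0: "\<forall>A\<in>down y. M A \<subseteq> D \<and> disjoint_family_on (\<lambda>d. d) (M A) \<and>
      \<Union>(M A) \<subseteq> A \<and> A \<subseteq> X closure_of (\<Union>(M A))"
    by (elim exE)
  have M: "M A \<subseteq> D" "disjoint_family_on (\<lambda>d. d) (M A)"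
    "\<Union>(M A) \<subseteq> A" "A \<subseteq> X closure_of (\<Union>(M A))" if "A \<in> down y" for A
    using bspec[OF M0 that] by auto
  have M_inj: "A = B" if "A \<in> down y" "B \<in> down y" "M A = M B" for A B
  proof -
    have "A \<subseteq> B" if "A \<in> down y" "B \<in> down y" "M A = M B" for A B
      by (rule subset_by_pieces[of _ "\<lambda>d. d" "M A"]) (use that M[of A] M[of B] in \<open>auto intro: regs_open\<close>)
    then show ?thesis using that by blast
  qed
  obtain cls :: "'a set set \<Rightarrow> 'a set" where cls: "\<And>K. K \<lesssim> D \<Longrightarrow> cls K \<in> D"
    "\<And>K K'. K \<lesssim> D \<Longrightarrow> K' \<lesssim> D \<Longrightarrow> cls K = cls K' \<Longrightarrow> K \<approx> K'"
    using equipollence_classes[OF inf] by metis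
  have MD: "M A \<lesssim> D" if "A \<in> down y" for A using M(1)[OF that] by (rule subset_imp_lepoll)
  \<comment> \<open>One representative per code. \<open>N A\<close> depends only on the code of
    \<open>M A\<close>, so sets with equal codes share the index family \<open>N A\<close>, and each
    lists its own \<open>M A\<close> along it by a bijection \<open>g A\<close>.\<close>
  define rep where "rep k = (SOME A. A \<in> down y \<and> cls (M A) = k)" for k
  define N where "N A = M (rep (cls (M A)))" for A
  have rep: "rep (cls (M A)) \<in> down y \<and> cls (M (rep (cls (M A)))) = cls (M A)" if "A \<in> down y" for A
    unfolding rep_def by (rule someI[of _ A]) (use that in auto)
  have "\<exists>g. bij_betw g (N A) (M A)" if "A \<in> down y" for A
    using cls(2)[OF MD MD, of "rep (cls (M A))" A] rep[OF that] that unfolding N_def eqpoll_def by blast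
  then obtain g where g: "\<And>A. A \<in> down y \<Longrightarrow> bij_betw (g A) (N A) (M A)" by metis
  \<comment> \<open>The cell \<open>m\<close> carries the value \<open>g A m\<close> as a member of
    an antichain in \<open>m\<close> indexed by \<open>D\<close>; \<open>t x\<close> does the same
    in \<open>x\<close> for the code of \<open>M A\<close>.\<close>
  define q where "q A = reg (\<Union>m\<in>N A. t m (g A m))" for A
  define S where "S A = reg (t x (cls (M A)) \<union> q A)" for A
  have N: "N A \<subseteq> D" "disjoint_family_on (\<lambda>d. d) (N A)" "\<Union>(N A) \<subseteq> y" if "A \<in> down y" for A
    using M(1-3)[of "rep (cls (M A))"] rep[OF that] unfolding N_def by auto
  have gD: "g A m \<in> D" if "A \<in> down y" "m \<in> N A" for A m
    using bij_betw_apply[OF g[OF that(1)] that(2)] M(1)[OF that(1)] by blast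
  have tN: "t m (g A m) \<in> down m" if "A \<in> down y" "m \<in> N A" for A m
    using t[of m "g A m"] gD[OF that] N(1)[OF that(1)] D that(2) by blast
  have q: "q A \<in> down y" if "A \<in> down y" for A
    unfolding q_def by (rule reg_in_down[OF _ xy(2)]) (use tN[OF that] N(3)[OF that] in auto)
  have q_Int: "q A \<inter> m = t m (g A m)" if "A \<in> down y" "m \<in> N A" for A m
    unfolding q_def
  proof (rule reg_UN_Int[OF N(2)[OF that(1)] _ _ _ that(2)])
    fix i assume "i \<in> N A"
    then show "openin X i" "t i (g A i) \<subseteq> i" "t i (g A i) \<in> regs"
      using tN[OF that(1)] subsetD[OF N(1)[OF that(1)]] D by (auto intro: regs_open)
  qed
  have p: "t x (cls (M A)) \<in> down x" if "A \<in> down y" for A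
    using t[OF xy(1,3,5)] cls(1)[OF MD[OF that]] by blast
  have S: "S A \<inter> x = t x (cls (M A))" "S A \<inter> y = q A" if "A \<in> down y" for A
    using reg_Un_Int[OF xy(1,2,7) p[OF that] q[OF that]] unfolding S_def by auto
  have S_inj: "A = B" if A: "A \<in> down y" and B: "B \<in> down y" and le: "S A \<subseteq> S B" for A B
  proof -
    \<comment> \<open>Inclusion on \<open>x\<close> forces equal codes, hence a common index family;
      inclusion on its cells then forces equal values, so \<open>M A = M B\<close>.\<close>
    have "t x (cls (M A)) \<subseteq> t x (cls (M B))" and qq: "q A \<subseteq> q B"
      using le S[OF A] S[OF B] by blast+
    then have ceq: "cls (M A) = cls (M B)"
      using t_inj[OF xy(1,3,5)] cls(1)[OF MD[OF A]] cls(1)[OF MD[OF B]] by blast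
    then have NN: "N A = N B" unfolding N_def by simp
    have "g A m = g B m" if "m \<in> N A" for m
    proof (rule t_inj)
      show "t m (g A m) \<subseteq> t m (g B m)"
        using q_Int[OF A that] q_Int[OF B] that qq NN by blast
      show "m \<in> regs" "m \<noteq> {}" "m \<subseteq> C" "g A m \<in> D" "g B m \<in> D"
        using gD[OF A that] gD[OF B] that NN N(1)[OF A] D by blast+
    qed
    then have "g A ` N A = g B ` N B" using NN by auto
    then have "M A = M B" using g[OF A] g[OF B] by (simp add: bij_betw_def)
    then show ?thesis using M_inj A B by blast
  qed
  have S_V: "S A \<in> down V" if "A \<in> down y" for A
    unfolding S_def by (rule reg_in_down) (use p[OF that] q[OF that] xy C VP in auto)
  \<comment> \<open>By homogeneity \<open>V\<close> has no more regular open subsets than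
    \<open>y\<close>, so encoding those of \<open>y\<close> suffices.\<close>
  have "down V \<lesssim> down y"
    using V(1) xy(2,4) subset_trans[OF xy(6) C(2)] unfolding homogeneous_def by simp
  then obtain j where j: "inj_on j (down V)" "\<And>A. A \<in> down V \<Longrightarrow> j A \<in> down y"
    unfolding lepoll_def by blast
  have "antichain_embedding V V (\<lambda>A. S (j A))"
    unfolding antichain_embedding_def
  proof (intro conjI ballI impI)
    fix u v assume uv: "u \<in> down V" "v \<in> down V" "S (j u) \<subseteq> S (j v)"
    then have "j u = j v" using S_inj j(2) by blast
    then show "u = v" using uv inj_onD[OF j(1)] by blast
  qed (rule S_V[OF j(2)])
  then show ?thesis by blast
qed

section \<open>Gluing over disjoint families, and twin decompositions\<close>

lemma openin_UN_regs: "(\<And>t. t \<in> I \<Longrightarrow> f t \<in> regs) \<Longrightarrow> openin X (\<Union>t\<in>I. f t)"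
  by (intro openin_Union) (auto simp: regs_open)

lemma down_reg_subset_closure: "u \<in> down (reg W) \<Longrightarrow> u \<subseteq> X closure_of W"
  using reg_subset_closure[of W] by auto

lemma reg_disjoint:
  assumes "openin X A" "A \<inter> B = {}"
  shows "reg A \<inter> reg B = {}"
proof -
  have "A \<inter> reg B = {}"
    using Int_closure_empty[OF assms] reg_subset_closure[of B] by auto
  then have "reg B \<inter> X closure_of A = {}"
    by (intro Int_closure_empty) auto
  then show ?thesis using reg_subset_closure[of A] by auto
qed

text \<open>Injections for the single cells are glued: the traces of \<open>F u\<close> on the
  \<open>z' t\<close> return the traces of \<open>u\<close> on the \<open>z t\<close>, and these
  determine \<open>u\<close>.\<close>

lemma down_UN_lepoll:
  assumes z: "disjoint_family_on z I" "\<And>t. t \<in> I \<Longrightarrow> z t \<in> regs"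
    and z': "disjoint_family_on z' I" "\<And>t. t \<in> I \<Longrightarrow> z' t \<in> regs"
    and le: "\<And>t. t \<in> I \<Longrightarrow> down (z t) \<lesssim> down (z' t)"
  shows "down (reg (\<Union>t\<in>I. z t)) \<lesssim> down (reg (\<Union>t\<in>I. z' t))"
proof -
  have "\<forall>t\<in>I. \<exists>h. inj_on h (down (z t)) \<and> h ` down (z t) \<subseteq> down (z' t)"
    using le unfolding lepoll_def by (rule ballI)
  from bchoice[OF this] obtain h where h: "\<forall>t\<in>I. inj_on (h t) (down (z t)) \<and> h t ` down (z t) \<subseteq> down (z' t)"
    by (elim exE)
  define F where "F u = reg (\<Union>t\<in>I. h t (u \<inter> z t))" for u
  let ?A = "reg (\<Union>t\<in>I. z t)" and ?B = "reg (\<Union>t\<in>I. z' t)"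
  have uz: "u \<inter> z t \<in> down (z t)" if "u \<in> down ?A" "t \<in> I" for u t
    using that z(2) by (simp add: regs_Int)
  have hz: "h t (u \<inter> z t) \<in> down (z' t)" if "u \<in> down ?A" "t \<in> I" for u t
    using h that uz[OF that] by blast
  have F_Int: "F u \<inter> z' t = h t (u \<inter> z t)" if "u \<in> down ?A" "t \<in> I" for u t
    unfolding F_def
  proof (rule reg_UN_Int[OF z'(1) _ _ _ that(2)])
    fix s assume "s \<in> I"
    then show "openin X (z' s)" "h s (u \<inter> z s) \<subseteq> z' s" "h s (u \<inter> z s) \<in> regs"
      using hz[OF that(1), of s] z'(2) by (auto intro: regs_open)
  qed
  have "F u \<in> down ?B" if "u \<in> down ?A" for u
  proof -
    have "(\<Union>t\<in>I. h t (u \<inter> z t)) \<subseteq> (\<Union>t\<in>I. z' t)" using hz[OF that] by auto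
    then show ?thesis unfolding F_def by (simp add: reg_mono)
  qed
  moreover have "inj_on F (down ?A)"
  proof (rule inj_onI)
    have "u \<subseteq> v" if uv: "u \<in> down ?A" "v \<in> down ?A" "F u = F v" for u v
    proof (rule subset_by_pieces)
      show "openin X u" "v \<in> regs" using uv by (auto intro: regs_open)
      show "u \<subseteq> X closure_of (\<Union>t\<in>I. z t)" using uv(1) by (rule down_reg_subset_closure)
      fix t assume t: "t \<in> I"
      have "h t (u \<inter> z t) = h t (v \<inter> z t)" using F_Int uv t by metis
      then have "u \<inter> z t = v \<inter> z t" using h t uz uv by (meson inj_onD)
      then show "u \<inter> z t \<subseteq> v" by blast
    qed
    then show "u = v" if "u \<in> down ?A" "v \<in> down ?A" "F u = F v" for u v
      using that by (metis subset_antisym)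
  qed
  ultimately show ?thesis unfolding lepoll_def by blast
qed

text \<open>The pieces from which an arbitrary infinite \<open>down A\<close> is handled: the two
  members provide the equal splitting, their join the antichain. Allowing the antichain to use both
  members makes a pair of atoms admissible.\<close>

definition twins where
  "twins p \<longleftrightarrow> fst p \<in> regs \<and> snd p \<in> regs \<and> fst p \<noteq> {} \<and> snd p \<noteq> {} \<and> fst p \<inter> snd p = {} \<and>
     down (fst p) \<lesssim> down (snd p) \<and> down (snd p) \<lesssim> down (fst p) \<and>
     (\<exists>T. antichain_embedding (fst p) (reg (fst p \<union> snd p)) T)"

text \<open>Any two disjoint non-empty parts of \<open>V\<close> have equally many regular open
  subsets, and the first, being homogeneous and non-atomic, already carries an antichain.\<close>

lemma twins_in_homogeneous:
  assumes "homogeneous V" "\<not> atomic V"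
  shows "\<exists>p. twins p \<and> fst p \<union> snd p \<subseteq> V"
proof -
  have V: "V \<in> regs" using assms unfolding homogeneous_def by auto
  obtain x y where xy: "x \<in> regs" "y \<in> regs" "x \<noteq> {}" "y \<noteq> {}" "x \<subseteq> V" "y \<subseteq> V" "x \<inter> y = {}"
    using split_not_atomic[OF V assms(2)] by auto
  have hom: "homogeneous x" using homogeneous_subset[OF assms(1) xy(1,3,5)] .
  have "\<not> atomic x" using not_atomic_subset[OF assms xy(1,3,5)] .
  then obtain T where T: "antichain_embedding x x T"
    using homogeneous_antichain_embedding[OF hom] by auto
  have "x \<subseteq> reg (x \<union> y)" using subset_reg[of "x \<union> y"] xy(1,2) by (auto simp: regs_open openin_Un)
  then have "antichain_embedding x (reg (x \<union> y)) T"
    using T unfolding antichain_embedding_def by auto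
  moreover have "down a \<lesssim> down b" if "a \<subseteq> V" "b \<in> regs" "b \<noteq> {}" "b \<subseteq> V" for a b
  proof -
    have "down V \<lesssim> down b" using assms(1) that unfolding homogeneous_def by auto
    then show ?thesis by (rule lepoll_trans[OF down_mono[OF that(1)]])
  qed
  ultimately have "twins (x, y)" using xy unfolding twins_def by auto
  then show ?thesis using xy by (intro exI[of _ "(x, y)"]) auto
qed

lemma down_atomic: "atomic V \<Longrightarrow> down V \<subseteq> {{}, V}"
  unfolding atomic_def by auto

text \<open>Each atom has two regular open subsets, and the two atoms themselves form an antichain
  of that size.\<close>

lemma twins_atomic:
  assumes "x \<in> regs" "y \<in> regs" "x \<noteq> {}" "y \<noteq> {}" "x \<inter> y = {}" "atomic x" "atomic y"
  shows "twins (x, y)"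
proof -
  have "down x = {{}, x}" "down y = {{}, y}"
    using assms down_atomic[of x] down_atomic[of y] by auto
  then have "down x \<approx> down y"
    using assms(3,4) by (simp add: eqpoll_doubleton_iff) metis
  moreover have sub: "x \<union> y \<subseteq> reg (x \<union> y)" using assms(1,2) by (intro subset_reg openin_Un regs_open)
  have "antichain_embedding x (reg (x \<union> y)) (\<lambda>u. if u = {} then x else y)"
    unfolding antichain_embedding_def \<open>down x = {{}, x}\<close> using assms sub by auto
  ultimately show ?thesis unfolding twins_def using assms by (auto intro: eqpoll_imp_lepoll eqpoll_sym)
qed

text \<open>Take a maximal disjoint family of twins. The remainder \<open>r\<close> contains no
  twins, so it is empty or an atom. Traces on the two joins and on \<open>r\<close> embed
  \<open>down A\<close> in a product of two sets of the same infinite size and a finite set.\<close>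

lemma twin_decomposition:
  assumes A: "A \<in> regs" "infinite (down A)"
  obtains I where "\<forall>p\<in>I. twins p \<and> fst p \<union> snd p \<subseteq> A"
    "disjoint_family_on (\<lambda>p. fst p \<union> snd p) I"
    "down A \<lesssim> down (reg (\<Union>p\<in>I. fst p))" "down A \<lesssim> down (reg (\<Union>p\<in>I. snd p))"
proof -
  let ?J = "{p. twins p \<and> fst p \<union> snd p \<subseteq> A}" and ?z = "\<lambda>p. fst p \<union> snd p :: 'a set"
  obtain I where I: "I \<subseteq> ?J" "disjoint_family_on ?z I"
    and max: "\<forall>p\<in>?J. (\<forall>i\<in>I. ?z i \<inter> ?z p = {}) \<longrightarrow> p \<in> I"
    using maximal_disjoint_subfamily[of ?J ?z] by (elim exE conjE)
  have tw: "twins p" "?z p \<subseteq> A" "fst p \<in> regs" "snd p \<in> regs" if "p \<in> I" for p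
    using I(1) that unfolding twins_def by auto
  define Z where "Z = (\<Union>p\<in>I. ?z p)"
  define r where "r = A - X closure_of Z"
  have xo: "openin X (\<Union>p\<in>I. fst p)" and yo: "openin X (\<Union>p\<in>I. snd p)"
    by (rule openin_UN_regs, rule tw, assumption)+
  have Zo: "openin X Z" unfolding Z_def UN_Un_distrib by (intro openin_Un xo yo)
  have r: "r \<in> regs" "r \<inter> Z = {}"
    unfolding r_def by (rule regs_diff[OF A(1) Zo], rule diff_closure_disjoint[OF Zo])
  have no_twins: False if "twins p" "?z p \<subseteq> r" for p
  proof -
    have "p \<in> ?J" using that unfolding r_def by auto
    moreover have "\<forall>i\<in>I. ?z i \<inter> ?z p = {}" using that(2) r(2) unfolding Z_def by blast
    ultimately have "p \<in> I" using max by blast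
    then have "?z p \<subseteq> Z" unfolding Z_def by auto
    then show False using that r(2) unfolding twins_def by blast
  qed
  have cell_atomic: "atomic V" if "homogeneous V" "V \<subseteq> r" for V
    using twins_in_homogeneous[OF that(1)] no_twins that(2) by (meson subset_trans)
  have "finite (down r)"
  proof (cases "r = {}")
    case True
    then have "down r \<subseteq> {{}}" by auto
    then show ?thesis by (rule finite_subset) simp
  next
    case False
    then obtain v where v: "homogeneous v" "v \<subseteq> r" using exists_homogeneous[OF r(1)] by auto
    then have v': "atomic v" "v \<in> regs" "v \<noteq> {}" using cell_atomic unfolding homogeneous_def by auto
    \<comment> \<open>Otherwise the complement of \<open>v\<close> in \<open>r\<close> contains a
      second atom, and two disjoint atoms are twins.\<close>
    have "v = r"
    proof (rule ccontr)
      assume "v \<noteq> r"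
      define s where "s = r - X closure_of v"
      have "\<not> r \<subseteq> v" using \<open>v \<noteq> r\<close> v by auto
      then have s: "s \<in> regs" "s \<noteq> {}" "s \<inter> v = {}" "s \<subseteq> r"
        unfolding s_def using regs_diff[OF r(1) regs_open[OF v'(2)]] regs_diff_nonempty[OF r(1) v'(2)]
          diff_closure_disjoint[OF regs_open[OF v'(2)]] by auto
      then obtain w where w: "homogeneous w" "w \<subseteq> s" using exists_homogeneous by blast
      then have "atomic w" "w \<in> regs" "w \<noteq> {}" using cell_atomic s unfolding homogeneous_def by auto
      then have "twins (v, w)" using v' w s by (intro twins_atomic) auto
      then show False using no_twins[of "(v, w)"] v w s by auto
    qed
    then show ?thesis using v'(1) finite_subset[OF down_atomic] by blast
  qed
  let ?x = "reg (\<Union>p\<in>I. fst p)" and ?y = "reg (\<Union>p\<in>I. snd p)"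
  have dfst: "disjoint_family_on fst I" and dsnd: "disjoint_family_on snd I"
    using I(2) unfolding disjoint_family_on_def by blast+
  have xy: "down ?x \<lesssim> down ?y"
    by (rule down_UN_lepoll[OF dfst _ dsnd]) (use tw in \<open>auto simp: twins_def\<close>)
  have yx: "down ?y \<lesssim> down ?x"
    by (rule down_UN_lepoll[OF dsnd _ dfst]) (use tw in \<open>auto simp: twins_def\<close>)
  have cover: "A \<subseteq> X closure_of (\<Union>t\<in>{?x, ?y, r}. t)"
  proof -
    have "(\<Union>p\<in>I. fst p) \<subseteq> ?x" "(\<Union>p\<in>I. snd p) \<subseteq> ?y"
      by (rule subset_reg, rule xo yo)+
    then have "Z \<subseteq> (\<Union>t\<in>{?x, ?y, r}. t)" unfolding Z_def by auto
    then have "X closure_of Z \<subseteq> X closure_of (\<Union>t\<in>{?x, ?y, r}. t)" by (rule closure_of_mono)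
    moreover have "r \<subseteq> X closure_of (\<Union>t\<in>{?x, ?y, r}. t)"
      by (rule subset_trans[OF closure_of_subset closure_of_mono]) (use regs_open[OF r(1)] openin_subset in auto)
    ultimately show ?thesis unfolding r_def by blast
  qed
  define F where "F u = (u \<inter> ?x, u \<inter> ?y, u \<inter> r)" for u
  have "inj_on F (down A)"
  proof (rule inj_onI)
    have "u \<subseteq> v" if uv: "u \<in> down A" "v \<in> down A" "F u = F v" for u v
    proof (rule subset_by_pieces[of u "\<lambda>t. t" "{?x, ?y, r}" v])
      show "openin X u" "v \<in> regs" using uv by (auto intro: regs_open)
      show "u \<subseteq> X closure_of (\<Union>t\<in>{?x, ?y, r}. t)" using uv(1) cover by (meson down_iff subset_trans)
      show "u \<inter> t \<subseteq> v" if "t \<in> {?x, ?y, r}" for t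
        using uv(3) that unfolding F_def by auto
    qed
    then show "u = v" if "u \<in> down A" "v \<in> down A" "F u = F v" for u v
      using that by (metis subset_antisym)
  qed
  moreover have "F ` down A \<subseteq> down ?x \<times> down ?y \<times> down r"
    using r(1) unfolding F_def by (auto simp: regs_Int)
  ultimately have le: "down A \<lesssim> down ?x \<times> down ?y \<times> down r" unfolding lepoll_def by blast
  have inf: "infinite (down ?x)"
  proof
    assume "finite (down ?x)"
    then have "finite (down ?x \<times> down ?y \<times> down r)"
      using lepoll_finite[OF yx] \<open>finite (down r)\<close> by simp
    then show False using lepoll_finite[OF le] A(2) by blast
  qed
  have "down ?y \<times> down r \<lesssim> down ?x \<times> down ?x"
    by (intro times_lepoll_mono yx finite_lepoll_infinite inf \<open>finite (down r)\<close>)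
  then have "down ?y \<times> down r \<lesssim> down ?x"
    using times_self_lepoll[OF inf] by (rule lepoll_trans)
  then have "down ?x \<times> down ?y \<times> down r \<lesssim> down ?x \<times> down ?x"
    by (intro times_lepoll_mono lepoll_refl)
  then have "down A \<lesssim> down ?x"
    using le times_self_lepoll[OF inf] by (meson lepoll_trans)
  moreover have "\<forall>p\<in>I. twins p \<and> ?z p \<subseteq> A" using tw by auto
  ultimately show ?thesis using that[OF _ I(2)] lepoll_trans[OF _ xy] by blast
qed

text \<open>The two sets are the joins of the first and of the second members of a twin
  decomposition.\<close>

lemma exists_equal_split:
  assumes A: "A \<in> regs" "infinite (down A)"
  shows "\<exists>x\<in>down A. \<exists>y\<in>down A. x \<inter> y = {} \<and> down A \<lesssim> down x \<and> down A \<lesssim> down y"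
proof -
  obtain I where I: "\<forall>p\<in>I. twins p \<and> fst p \<union> snd p \<subseteq> A"
    "disjoint_family_on (\<lambda>p. fst p \<union> snd p) I"
    "down A \<lesssim> down (reg (\<Union>p\<in>I. fst p))" "down A \<lesssim> down (reg (\<Union>p\<in>I. snd p))"
    using A by (rule twin_decomposition)
  have op: "openin X (\<Union>p\<in>I. fst p)" "openin X (\<Union>p\<in>I. snd p)"
    by (rule openin_UN_regs, use I(1) in \<open>simp add: twins_def\<close>)+
  have "fst p \<inter> snd q = {}" if "p \<in> I" "q \<in> I" for p q
  proof (cases "p = q")
    case True
    then show ?thesis using I(1) that unfolding twins_def by auto
  next
    case False
    then show ?thesis using disjoint_family_onD[OF I(2) that] by auto
  qed
  then have dis: "(\<Union>p\<in>I. fst p) \<inter> (\<Union>p\<in>I. snd p) = {}" by blast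
  then have "reg (\<Union>p\<in>I. fst p) \<inter> reg (\<Union>p\<in>I. snd p) = {}"
    by (rule reg_disjoint[OF op(1)])
  moreover have "reg (\<Union>p\<in>I. fst p) \<in> down A" "reg (\<Union>p\<in>I. snd p) \<in> down A"
    by (rule reg_in_down[OF _ A(1)]; use I(1) in auto)+
  ultimately show ?thesis using I(3,4) by blast
qed

text \<open>The antichains of the twins are multiplied: an inclusion between values of
  \<open>F\<close> holds in every cell, so it forces equality of the traces on all
  \<open>fst p\<close>, and these determine a subset of the join of the first members, where
  \<open>down A\<close> can be injected.\<close>

lemma exists_antichain_embedding:
  assumes A: "A \<in> regs" "infinite (down A)"
  shows "\<exists>T. antichain_embedding A A T"
proof -
  obtain I where I: "\<forall>p\<in>I. twins p \<and> fst p \<union> snd p \<subseteq> A"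
    "disjoint_family_on (\<lambda>p. fst p \<union> snd p) I"
    "down A \<lesssim> down (reg (\<Union>p\<in>I. fst p))" "down A \<lesssim> down (reg (\<Union>p\<in>I. snd p))"
    using A by (rule twin_decomposition)
  let ?x = "reg (\<Union>p\<in>I. fst p)" and ?z = "\<lambda>p. reg (fst p \<union> snd p)"
  have "\<forall>p\<in>I. \<exists>T. antichain_embedding (fst p) (?z p) T" using I(1) unfolding twins_def by blast
  from bchoice[OF this] obtain T where T: "\<forall>p\<in>I. antichain_embedding (fst p) (?z p) (T p)" by (elim exE)
  have p_regs: "fst p \<in> regs" "snd p \<in> regs" if "p \<in> I" for p using I(1) that unfolding twins_def by auto
  have zA: "?z p \<subseteq> A" if "p \<in> I" for p using I(1) that A(1) by (intro reg_minimal) auto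
  have dis: "disjoint_family_on ?z I"
    unfolding disjoint_family_on_def
  proof (intro ballI impI)
    fix p q assume pq: "p \<in> I" "q \<in> I" "p \<noteq> q"
    have op: "openin X (fst p \<union> snd p)" using p_regs[OF pq(1)] by (intro openin_Un regs_open)
    show "?z p \<inter> ?z q = {}"
      by (rule reg_disjoint[OF op disjoint_family_onD[OF I(2) pq]])
  qed
  have up: "u \<inter> fst p \<in> down (fst p)" if "u \<in> regs" "p \<in> I" for u p
    using p_regs that by (simp add: regs_Int)
  have Tp: "T p (u \<inter> fst p) \<in> down (?z p)" if "u \<in> regs" "p \<in> I" for u p
    using T up[OF that] that(2) unfolding antichain_embedding_def by blast
  define F where "F u = reg (\<Union>p\<in>I. T p (u \<inter> fst p))" for u
  have F_Int: "F u \<inter> ?z p = T p (u \<inter> fst p)" if "u \<in> regs" "p \<in> I" for u p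
    unfolding F_def
    by (rule reg_UN_Int[OF dis _ _ _ that(2)]) (use Tp[OF that(1)] in auto)
  have F_A: "F u \<in> down A" if "u \<in> regs" for u
    unfolding F_def
  proof (rule reg_in_down[OF _ A(1)], rule UN_least)
    show "T p (u \<inter> fst p) \<subseteq> A" if "p \<in> I" for p
      using Tp[OF \<open>u \<in> regs\<close> that] zA[OF that] by auto
  qed
  have F_anti: "u = v" if uv: "u \<in> down ?x" "v \<in> down ?x" "F u \<subseteq> F v" for u v
  proof -
    have pieces: "u \<inter> fst p = v \<inter> fst p" if p: "p \<in> I" for p
    proof -
      have "T p (u \<inter> fst p) \<subseteq> T p (v \<inter> fst p)"
        using F_Int[of u p] F_Int[of v p] uv p by auto
      then show ?thesis
        using T p up[of u p] up[of v p] uv unfolding antichain_embedding_def by auto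
    qed
    have le: "a \<subseteq> b" if "a \<in> down ?x" "b \<in> down ?x" "\<And>p. p \<in> I \<Longrightarrow> a \<inter> fst p = b \<inter> fst p" for a b
    proof (rule subset_by_pieces)
      show "openin X a" "b \<in> regs" using that by (auto intro: regs_open)
      show "a \<subseteq> X closure_of (\<Union>p\<in>I. fst p)" using that(1) by (rule down_reg_subset_closure)
    qed (use that(3) in blast)
    show ?thesis using le[OF uv(1,2)] le[OF uv(2,1)] pieces by blast
  qed
  obtain j where j: "inj_on j (down A)" "j ` down A \<subseteq> down ?x"
    using I(3) unfolding lepoll_def by blast
  have "antichain_embedding A A (\<lambda>u. F (j u))"
    unfolding antichain_embedding_def
  proof (intro conjI ballI impI)
    fix u assume "u \<in> down A"
    then have "j u \<in> down ?x" using j(2) by blast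
    then show "F (j u) \<in> down A" by (intro F_A) simp
  next
    fix u v assume uv: "u \<in> down A" "v \<in> down A" "F (j u) \<subseteq> F (j v)"
    then have "j u = j v" using F_anti j(2) by blast
    then show "u = v" using uv inj_onD[OF j(1)] by blast
  qed
  then show ?thesis by blast
qed

end

section \<open>Codes and colours\<close>

context
  fixes X :: "'a topology" and L :: "'b set"
begin

definition big where
  "big A \<longleftrightarrow> A \<in> regs X \<and> L \<lesssim> down X A"

text \<open>Abstracts the encoding of an index in a big part of \<open>A\<close>. In the second
  clause only the codes increase, not the sets \<open>A n\<close>, since a chain of base sets shows
  its traces on \<open>C\<close> only through their codes.\<close>

definition coding where
  "coding C S \<longleftrightarrow>
     (\<forall>A i. big A \<longrightarrow> A \<subseteq> C \<longrightarrow> i \<in> L \<longrightarrow> big (S A i) \<and> S A i \<subseteq> A) \<and>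
     (\<forall>A i. (\<forall>n::nat. big (A n) \<and> A n \<subseteq> C \<and> i n \<in> L \<and> S (A n) (i n) \<subseteq> S (A (Suc n)) (i (Suc n))) \<longrightarrow>
        (\<exists>m. \<forall>n\<ge>m. i n = i m \<and> S (A n) (i n) = S (A m) (i m)))"

lemma big_mono: "big A \<Longrightarrow> A \<subseteq> B \<Longrightarrow> B \<in> regs X \<Longrightarrow> big B"
  unfolding big_def by (meson down_mono lepoll_trans)

text \<open>The sets \<open>d k\<close> are left-separated in the strong sense that no later one contains the part
  \<open>e (d j)\<close> of an earlier one. As \<open>S A i\<close> lies between \<open>e (d k)\<close> and \<open>d k\<close> for some \<open>k \<subseteq> A\<close>, the index \<open>k\<close>
  cannot grow along an increasing sequence.\<close>
lemma exists_coding: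
  assumes inf: "infinite L" and "big B"
  shows "\<exists>C\<subseteq>B. big C \<and> (\<exists>S. coding C S)"
proof -
  have "B \<in> {u. big u}" using assms by simp
  then obtain C D where C: "C \<in> {u. big u}" "C \<subseteq> B"
    and D: "\<forall>d\<in>D. d \<in> {u. big u} \<and> d \<subseteq> C"
    and dense: "\<forall>u\<in>{u. big u}. u \<subseteq> C \<longrightarrow> (\<exists>d\<in>D. d \<subseteq> u)"
    and sparse: "\<forall>C'\<in>{u. big u}. C' \<subseteq> C \<longrightarrow> (\<forall>E\<subseteq>{u. big u}. \<not> D \<lesssim> E \<longrightarrow>
      (\<exists>u\<in>{u. big u}. u \<subseteq> C' \<and> (\<forall>e\<in>E. \<not> e \<subseteq> u)))"
    by (rule exists_homogeneous_density)
  have "\<forall>u\<in>{u. big u}. \<exists>p. big (fst p) \<and> fst p \<subseteq> u \<and> fst (snd p) \<in> down X u \<and> fst p \<inter> fst (snd p) = {} \<and>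
      (\<forall>i\<in>L. snd (snd p) i \<in> down X (fst (snd p))) \<and>
      (\<forall>i\<in>L. \<forall>j\<in>L. snd (snd p) i \<subseteq> snd (snd p) j \<longrightarrow> i = j)"
  proof
    fix u assume "u \<in> {u. big u}"
    then have u: "u \<in> regs X" "L \<lesssim> down X u" unfolding big_def by auto
    then have "infinite (down X u)" using inf lepoll_finite by blast
    then obtain x y where xy: "x \<in> down X u" "y \<in> down X u" "x \<inter> y = {}"
      "down X u \<lesssim> down X x" "down X u \<lesssim> down X y"
      using exists_equal_split[OF u(1)] by auto
    then have Lx: "L \<lesssim> down X x" "L \<lesssim> down X y" using u(2) by (meson lepoll_trans)+
    then have "infinite (down X y)" using inf lepoll_finite by blast
    then obtain T where T: "antichain_embedding X y y T"
      using exists_antichain_embedding[of y X] xy by auto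
    obtain j where j: "inj_on j L" "j ` L \<subseteq> down X y" using Lx(2) unfolding lepoll_def by blast
    have "T (j i) \<in> down X y" if "i \<in> L" for i
      using T j(2) that unfolding antichain_embedding_def by blast
    moreover have "i = k" if "i \<in> L" "k \<in> L" "T (j i) \<subseteq> T (j k)" for i k
    proof -
      have "j i \<in> down X y" "j k \<in> down X y" using j(2) that(1,2) by blast+
      then have "j i = j k" using T that(3) unfolding antichain_embedding_def by blast
      then show ?thesis using inj_onD[OF j(1) _ that(1,2)] by blast
    qed
    ultimately show "\<exists>p. big (fst p) \<and> fst p \<subseteq> u \<and> fst (snd p) \<in> down X u \<and> fst p \<inter> fst (snd p) = {} \<and>
        (\<forall>i\<in>L. snd (snd p) i \<in> down X (fst (snd p))) \<and>
        (\<forall>i\<in>L. \<forall>j\<in>L. snd (snd p) i \<subseteq> snd (snd p) j \<longrightarrow> i = j)"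
      using xy Lx by (intro exI[of _ "(x, y, \<lambda>i. T (j i))"]) (simp add: big_def)
  qed
  from bchoice[OF this] obtain f where f: "\<forall>u\<in>{u. big u}. big (fst (f u)) \<and> fst (f u) \<subseteq> u \<and>
      fst (snd (f u)) \<in> down X u \<and> fst (f u) \<inter> fst (snd (f u)) = {} \<and>
      (\<forall>i\<in>L. snd (snd (f u)) i \<in> down X (fst (snd (f u)))) \<and>
      (\<forall>i\<in>L. \<forall>j\<in>L. snd (snd (f u)) i \<subseteq> snd (snd (f u)) j \<longrightarrow> i = j)"
    by (elim exE)
  \<comment> \<open>A big \<open>u\<close> is given a big part \<open>e u\<close>, which keeps the
    codes big, and a disjoint part \<open>e' u\<close> with an antichain \<open>T u\<close> indexed
    by \<open>L\<close>, which carries the index.\<close>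
  define e where "e u = fst (f u)" for u
  define e' where "e' u = fst (snd (f u))" for u
  define T where "T u = snd (snd (f u))" for u
  have e: "big (e u)" "e u \<subseteq> u" "e u \<in> regs X" "e' u \<in> regs X" "e' u \<subseteq> u" "e u \<inter> e' u = {}"
    and T: "\<And>i. i \<in> L \<Longrightarrow> T u i \<in> down X (e' u)"
    and T_inj: "\<And>i j. i \<in> L \<Longrightarrow> j \<in> L \<Longrightarrow> T u i \<subseteq> T u j \<Longrightarrow> i = j" if "big u" for u
    using bspec[OF f, of u] that unfolding e_def e'_def T_def by (simp_all add: big_def)
  obtain d where d0: "\<forall>x\<in>D. d x \<in> {u. big u} \<and> d x \<subseteq> x \<and> (\<forall>y. (y, x) \<in> card_less D \<longrightarrow> \<not> e (d y) \<subseteq> d x)"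
    using left_separated_choice[OF sparse, where a = "\<lambda>x. x" and h = e] D e(1) by auto
  have d: "big (d k)" "d k \<subseteq> k" if "k \<in> D" for k using d0 that by auto
  have d_sep: "\<not> e (d j) \<subseteq> d k" if "(j, k) \<in> card_less D" "k \<in> D" for j k using d0 that by auto
  define k where "k A = (SOME d. d \<in> D \<and> d \<subseteq> A)" for A
  have k: "k A \<in> D \<and> k A \<subseteq> A" if "big A" "A \<subseteq> C" for A
  proof -
    have "\<exists>d. d \<in> D \<and> d \<subseteq> A" using dense that by auto
    then show ?thesis unfolding k_def by (rule someI_ex)
  qed
  define S where "S A i = reg X (e (d (k A)) \<union> T (d (k A)) i)" for A i
  have S: "big (S A i)" "e (d (k A)) \<subseteq> S A i" "S A i \<subseteq> d (k A)" "S A i \<inter> e' (d (k A)) = T (d (k A)) i"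
    if "big A" "A \<subseteq> C" "i \<in> L" for A i
  proof -
    have b: "big (d (k A))" using d k that by auto
    note Ti = T[OF b that(3)]
    have ei: "S A i \<inter> e (d (k A)) = e (d (k A))" "S A i \<inter> e' (d (k A)) = T (d (k A)) i"
      using reg_Un_Int[OF e(3,4,6)[OF b] _ Ti] e(3)[OF b] unfolding S_def by auto
    then show "e (d (k A)) \<subseteq> S A i" "S A i \<inter> e' (d (k A)) = T (d (k A)) i" by auto
    show "S A i \<subseteq> d (k A)" unfolding S_def
      by (rule reg_minimal) (use e[OF b] Ti b in \<open>auto simp: big_def\<close>)
    show "big (S A i)" by (rule big_mono[OF e(1)[OF b]]) (use ei in \<open>auto simp: S_def\<close>)
  qed
  have "coding C S"
    unfolding coding_def
  proof (intro conjI allI impI)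
    fix A i assume A: "big A" "A \<subseteq> C" "i \<in> L"
    show "big (S A i)" by (rule S(1)[OF A])
    show "S A i \<subseteq> A" using S(3)[OF A] k[OF A(1,2)] d(2)[of "k A"] by auto
  next
    fix A i
    assume *: "\<forall>n::nat. big (A n) \<and> A n \<subseteq> C \<and> i n \<in> L \<and> S (A n) (i n) \<subseteq> S (A (Suc n)) (i (Suc n))"
    then have A: "big (A n)" "A n \<subseteq> C" "i n \<in> L" and le: "S (A n) (i n) \<subseteq> S (A (Suc n)) (i (Suc n))" for n
      by auto
    have kD: "k (A n) \<in> D" for n using k[OF A(1,2)] by auto
    have "(k (A (Suc n)), k (A n)) \<in> card_less D \<or> k (A (Suc n)) = k (A n)" for n
    proof -
      have "e (d (k (A n))) \<subseteq> d (k (A (Suc n)))"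
        using S(2)[OF A, of n n] le[of n] S(3)[OF A, of "Suc n" "Suc n"] by auto
      then have "(k (A n), k (A (Suc n))) \<notin> card_less D" using d_sep kD by auto
      then show ?thesis using total_card_less[OF kD kD, of n "Suc n"] by auto
    qed
    from wf_descending_eventually_constant[OF wf_card_less[of D], of "\<lambda>n. k (A n)", OF this]
    obtain m where m: "\<forall>n\<ge>m. k (A n) = k (A m)" by (elim exE)
    \<comment> \<open>With \<open>k\<close> constant, the traces of the codes on one fixed
      \<open>e'\<close> are nested members of an antichain.\<close>
    have i_Suc: "i (Suc n) = i n" if "n \<ge> m" for n
    proof -
      note kk = m[rule_format, OF that] m[rule_format, OF le_SucI[OF that]]
      have "T (d (k (A m))) (i n) \<subseteq> T (d (k (A m))) (i (Suc n))"
        using S(4)[OF A, of n n] S(4)[OF A, of "Suc n" "Suc n"] le[of n] unfolding kk by auto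
      then show ?thesis using T_inj[OF d(1)[OF kD] A(3) A(3)] by metis
    qed
    have i: "i n = i m" if "n \<ge> m" for n
      using that by (induction rule: dec_induct) (use i_Suc in auto)
    have "i n = i m \<and> S (A n) (i n) = S (A m) (i m)" if "n \<ge> m" for n
      using i[OF that] m[rule_format, OF that] unfolding S_def by simp
    then show "\<exists>m. \<forall>n\<ge>m. i n = i m \<and> S (A n) (i n) = S (A m) (i m)" by blast
  qed
  then show ?thesis using C by auto
qed

definition small where
  "small A \<longleftrightarrow> A \<in> regs X \<and> down X A \<lesssim> L"

lemma small_subset: "small A \<Longrightarrow> B \<subseteq> A \<Longrightarrow> B \<in> regs X \<Longrightarrow> small B"
  unfolding small_def by (meson down_mono lepoll_trans)

text \<open>The colour of \<open>A\<close> consists of the cardinality of the set \<open>K A\<close> of cells meeting \<open>A\<close>, an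
  inclusion-distinguishing colour of \<open>K A\<close>, and the index of \<open>A\<close> among the sets with the same \<open>K A\<close>.\<close>
lemma exists_regular_open_coloring:
  assumes inf: "infinite L"
  shows "\<exists>c :: 'a set \<Rightarrow> 'b. (\<forall>A. small A \<longrightarrow> c A \<in> L) \<and>
    (\<forall>A B. small A \<longrightarrow> small B \<longrightarrow> A \<subseteq> B \<longrightarrow> c A = c B \<longrightarrow> A = B)"
proof -
  obtain H where H: "H \<subseteq> {V. homogeneous X V}" "disjoint_family_on (\<lambda>h. h) H"
    and max: "\<forall>V\<in>{V. homogeneous X V}. (\<forall>h\<in>H. h \<inter> V = {}) \<longrightarrow> V \<in> H"
    using maximal_disjoint_subfamily[of "{V. homogeneous X V}" "\<lambda>V. V"] by (elim exE conjE)
  have h: "homogeneous X h" "h \<in> regs X" if "h \<in> H" for h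
    using H(1) that unfolding homogeneous_def by auto
  define K where "K A = {h \<in> H. h \<inter> A \<noteq> {}}" for A
  have meets: "\<exists>h\<in>H. h \<inter> u \<noteq> {}" if u: "u \<in> regs X" "u \<noteq> {}" for u
  proof (rule ccontr)
    assume none: "\<not> ?thesis"
    obtain V where V: "V \<subseteq> u" "homogeneous X V" using exists_homogeneous[OF u] by auto
    then have "V \<in> H" using none max by blast
    then show False using V none unfolding homogeneous_def by blast
  qed
  have cover: "A \<subseteq> X closure_of (\<Union>h\<in>K A. h)" if A: "A \<in> regs X" for A
  proof (rule subset_closure_UN[OF A])
    fix u assume u: "u \<in> regs X" "u \<subseteq> A" "\<And>h. h \<in> K A \<Longrightarrow> h \<inter> u = {}"
    show "u = {}"
    proof (rule ccontr)
      assume "u \<noteq> {}"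
      then obtain h where "h \<in> H" "h \<inter> u \<noteq> {}" using meets[OF u(1)] by auto
      then show False using u(2) u(3)[of h] unfolding K_def by auto
    qed
  qed (use h in \<open>auto simp: K_def regs_open\<close>)
  have K_dis: "disjoint_family_on (\<lambda>h. h) (K A)" "disjoint_family_on (\<lambda>h. h \<inter> B) (K A)" for A B
    using H(2) unfolding K_def disjoint_family_on_def by auto
  have K_regs: "h \<in> regs X" "h \<inter> B \<in> regs X" if "h \<in> K A" "B \<in> regs X" for h A B
    using that h(2) unfolding K_def by (auto simp: regs_Int)
  \<comment> \<open>Joining the traces of \<open>A\<close> over different sets of cells gives
    different regular open subsets of \<open>A\<close>.\<close>
  have Pow_K: "Pow (K A) \<lesssim> L" if A: "small A" for A
  proof -
    have AR: "A \<in> regs X" using A unfolding small_def by auto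
    define F where "F M = reg X (\<Union>h\<in>K A. if h \<in> M then h \<inter> A else {})" for M
    have F_Int: "F M \<inter> h = (if h \<in> M then h \<inter> A else {})" if "h \<in> K A" for M h
      unfolding F_def
      by (rule reg_UN_Int[OF K_dis(1) _ _ _ that]) (use K_regs[OF _ AR] in \<open>auto simp: regs_open\<close>)
    have "M \<subseteq> M'" if "M \<subseteq> K A" "F M = F M'" for M M'
    proof
      fix h assume "h \<in> M"
      then have "h \<in> K A" using that by auto
      then show "h \<in> M'" using F_Int[of h M] F_Int[of h M'] \<open>h \<in> M\<close> that(2)
        unfolding K_def by (auto split: if_splits)
    qed
    then have "inj_on F (Pow (K A))" by (intro inj_onI) (metis PowD subset_antisym)
    moreover have "F M \<in> down X A" for M unfolding F_def by (rule reg_in_down[OF _ AR]) auto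
    ultimately have "Pow (K A) \<lesssim> down X A" unfolding lepoll_def by blast
    then show ?thesis using A unfolding small_def by (meson lepoll_trans)
  qed
  have K_L: "K A \<lesssim> L" if "small A" for A
    using lepoll_trans[OF lepoll_Pow_self Pow_K[OF that]] .
  \<comment> \<open>By homogeneity a cell meeting \<open>A\<close> has no more regular open subsets
    than its trace on \<open>A\<close>; gluing bounds the number of sets that have the cells
    \<open>K A\<close>.\<close>
  have fibre: "down X (reg X (\<Union>h\<in>K A. h)) \<lesssim> L" if A: "small A" for A
  proof -
    have AR: "A \<in> regs X" using A unfolding small_def by auto
    have "down X (reg X (\<Union>h\<in>K A. h)) \<lesssim> down X (reg X (\<Union>h\<in>K A. h \<inter> A))"
    proof (rule down_UN_lepoll[OF K_dis(1) _ K_dis(2)])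
      fix h' assume h': "h' \<in> K A"
      show "h' \<in> regs X" "h' \<inter> A \<in> regs X" using K_regs[OF h' AR] by auto
      show "down X h' \<lesssim> down X (h' \<inter> A)"
        using h(1)[of h'] h' K_regs(2)[OF h' AR] unfolding homogeneous_def K_def by auto
    qed
    moreover have "reg X (\<Union>h\<in>K A. h \<inter> A) \<subseteq> A" by (rule reg_minimal[OF _ AR]) auto
    then have "down X (reg X (\<Union>h\<in>K A. h \<inter> A)) \<lesssim> down X A" by (rule down_mono)
    ultimately show ?thesis using A unfolding small_def by (meson lepoll_trans)
  qed
  \<comment> \<open>Chosen from the family of cells alone, so sets with the same \<open>K A\<close>
    are numbered by the same injection.\<close>
  define J where "J M = (SOME f. inj_on f (down X (reg X (\<Union>h\<in>M. h))) \<and> f ` down X (reg X (\<Union>h\<in>M. h)) \<subseteq> L)" for M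
  have J: "inj_on (J (K A)) (down X (reg X (\<Union>h\<in>K A. h)))" "J (K A) ` down X (reg X (\<Union>h\<in>K A. h)) \<subseteq> L"
    if "small A" for A
    using someI_ex[OF fibre[OF that, unfolded lepoll_def]] unfolding J_def by auto
  obtain cls :: "'a set set \<Rightarrow> 'b" where cls0: "(\<forall>M. M \<lesssim> L \<longrightarrow> cls M \<in> L) \<and>
     (\<forall>M M'. M \<lesssim> L \<longrightarrow> M' \<lesssim> L \<longrightarrow> cls M = cls M' \<longrightarrow> M \<approx> M')"
    using equipollence_classes[OF inf] by (elim exE)
  have cls: "cls M \<in> L" if "M \<lesssim> L" for M using cls0 that by auto
  have cls_eq: "M \<approx> M'" if "M \<lesssim> L" "M' \<lesssim> L" "cls M = cls M'" for M M' using cls0 that by auto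
  define rep where "rep x = (SOME A. small A \<and> cls (K A) = x)" for x
  \<comment> \<open>A family of the same cardinality as \<open>K A\<close>, common to all sets with
    this code; its power set still embeds in \<open>L\<close>, which leaves room for the colours
    \<open>w (N A)\<close>.\<close>
  define N where "N A = K (rep (cls (K A)))" for A
  have rep: "small (rep (cls (K A))) \<and> cls (K (rep (cls (K A)))) = cls (K A)" if "small A" for A
    unfolding rep_def by (rule someI[of _ A]) (use that in auto)
  have N: "N A \<approx> K A" "Pow (N A) \<lesssim> L" if "small A" for A
    using cls_eq[OF K_L K_L, of "rep (cls (K A))" A] rep[OF that] that Pow_K unfolding N_def by auto
  define w :: "'a set set \<Rightarrow> 'a set set \<Rightarrow> 'a set set" where
    "w N = (SOME w. (\<forall>K. w K \<subseteq> N) \<and> (\<forall>K K'. K \<subseteq> K' \<longrightarrow> K' \<lesssim> N \<longrightarrow> w K = w K' \<longrightarrow> K = K'))" for N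
  have w: "(\<forall>K. w N K \<subseteq> N) \<and> (\<forall>K K'. K \<subseteq> K' \<longrightarrow> K' \<lesssim> N \<longrightarrow> w N K = w N K' \<longrightarrow> K = K')"
    if "infinite N" for N
    unfolding w_def by (rule someI_ex[OF inclusion_coloring[OF that]])
  define \<iota> where "\<iota> N = (SOME f. inj_on f (Pow N) \<and> f ` Pow N \<subseteq> L)" for N :: "'a set set"
  have \<iota>: "inj_on (\<iota> (N A)) (Pow (N A))" "\<iota> (N A) ` Pow (N A) \<subseteq> L" if "small A" for A
    using someI_ex[OF N(2)[OF that, unfolded lepoll_def]] unfolding \<iota>_def by auto
  have "L \<times> L \<times> L \<lesssim> L \<times> L" by (intro times_lepoll_mono lepoll_refl times_self_lepoll inf)
  then have "L \<times> L \<times> L \<lesssim> L" using times_self_lepoll[OF inf] by (rule lepoll_trans)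
  then obtain t where t: "inj_on t (L \<times> L \<times> L)" "t ` (L \<times> L \<times> L) \<subseteq> L" unfolding lepoll_def by blast
  \<comment> \<open>For finite \<open>K A\<close> the value is a filler in \<open>L\<close>: nested
    finite sets of the same size are equal anyway.\<close>
  define v where "v A = (if finite (K A) then cls (K A) else \<iota> (N A) (w (N A) (K A)))" for A
  have inf_N: "infinite (N A)" if "small A" "infinite (K A)" for A
    using eqpoll_finite_iff[OF N(1)[OF that(1)]] that by auto
  have vL: "v A \<in> L" if "small A" for A
  proof (cases "finite (K A)")
    case True
    then show ?thesis using cls[OF K_L[OF that]] unfolding v_def by auto
  next
    case False
    then have "w (N A) (K A) \<in> Pow (N A)" using w inf_N that by auto
    then show ?thesis using \<iota>(2)[OF that] False unfolding v_def by auto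
  qed
  have A_down: "A \<in> down X (reg X (\<Union>h\<in>K A. h))" if "small A" for A
  proof -
    have "A \<in> regs X" using that unfolding small_def by simp
    then show ?thesis using reg_maximal[OF regs_open cover] by simp
  qed
  have JL: "J (K A) A \<in> L" if "small A" for A using J(2)[OF that] A_down[OF that] by blast
  define c where "c A = t (cls (K A), v A, J (K A) A)" for A
  have tup: "(cls (K A), v A, J (K A) A) \<in> L \<times> L \<times> L" if "small A" for A
    using cls[OF K_L[OF that]] vL[OF that] JL[OF that] by auto
  have "c A \<in> L" if "small A" for A using t(2) tup[OF that] unfolding c_def by blast
  moreover have "A = B" if A: "small A" and B: "small B" and AB: "A \<subseteq> B" "c A = c B" for A B
  proof -
    have eq: "cls (K A) = cls (K B)" "v A = v B" "J (K A) A = J (K B) B"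
      using inj_onD[OF t(1) AB(2)[unfolded c_def] tup[OF A] tup[OF B]] by auto
    have sub: "K A \<subseteq> K B" using AB(1) unfolding K_def by auto
    have KK: "K A \<approx> K B" using cls_eq[OF K_L[OF A] K_L[OF B] eq(1)] .
    have "K A = K B"
    proof (cases "finite (K B)")
      case True
      then have "card (K A) = card (K B)" using KK eqpoll_iff_card finite_subset[OF sub] by blast
      then show ?thesis using True sub by (simp add: card_subset_eq)
    next
      case False
      then have fA: "infinite (K A)" using eqpoll_finite_iff[OF KK] by simp
      have NN: "N A = N B" unfolding N_def eq(1) ..
      note wN = w[OF inf_N[OF B False]]
      have "\<iota> (N B) (w (N B) (K A)) = \<iota> (N B) (w (N B) (K B))"
        using eq(2) False fA unfolding v_def NN by simp
      then have "w (N B) (K A) = w (N B) (K B)"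
        using \<iota>(1)[OF B] wN by (meson PowI inj_onD)
      moreover have "K B \<lesssim> N B" using N(1)[OF B] by (simp add: eqpoll_imp_lepoll eqpoll_sym)
      ultimately show ?thesis using wN sub by blast
    qed
    then show ?thesis
      using inj_onD[OF J(1)[OF B] _ _ A_down[OF B], of A] eq(3) A_down[OF A] by simp
  qed
  ultimately show ?thesis by blast
qed

end

section \<open>The Noetherian outer base\<close>

lemma noetherianD:
  assumes "noetherian A" "\<forall>n::nat. f n \<in> A \<and> f n \<subset> f (Suc n)"
  shows False
  using exI[of "\<lambda>f. \<forall>n::nat. f n \<in> A \<and> f n \<subset> f (Suc n)", OF assms(2)] assms(1)
  unfolding noetherian_def by (rule notE[rotated])

text \<open>An increasing sequence has infinitely many terms in one of the two families, and these
  form a strictly increasing subsequence.\<close>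

lemma noetherian_Un:
  assumes "noetherian A" "noetherian B"
  shows "noetherian (A \<union> B)"
  unfolding noetherian_def
proof
  assume "\<exists>f :: nat \<Rightarrow> _. \<forall>n. f n \<in> A \<union> B \<and> f n \<subset> f (Suc n)"
  then obtain f :: "nat \<Rightarrow> _" where "\<forall>n. f n \<in> A \<union> B \<and> f n \<subset> f (Suc n)" by (elim exE)
  then have f: "\<And>n. f n \<in> A \<union> B" "\<And>n. f n \<subset> f (Suc n)" by auto
  have sub: False if C: "infinite {n. f n \<in> C}" "noetherian C" for C
  proof -
    obtain r :: "nat \<Rightarrow> nat" where r: "strict_mono r" "\<forall>n. r n \<in> {n. f n \<in> C}"
      using infinite_enumerate[OF C(1)] by auto
    have "f (r n) \<subset> f (r (Suc n))" for n
      using lift_Suc_mono_less[of f, OF f(2)] r(1) by (simp add: strict_mono_Suc_iff)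
    then have "\<forall>n. f (r n) \<in> C \<and> f (r n) \<subset> f (r (Suc n))" using r(2) by simp
    then show False by (rule noetherianD[OF C(2)])
  qed
  have "{n. f n \<in> A} \<union> {n. f n \<in> B} = UNIV" using f(1) by auto
  then have "infinite {n. f n \<in> A} \<or> infinite {n. f n \<in> B}"
    by (metis finite_UnI infinite_UNIV_nat)
  then show False using sub assms by auto
qed

context
  fixes X :: "'a topology" and L :: "'b set"
begin

section \<open>Neighbourhoods and the two kinds of points\<close>

lemma X_card_big: "p \<in> X_card X L \<Longrightarrow> U \<in> regs X \<Longrightarrow> p \<in> U \<Longrightarrow> big X L U"
  unfolding X_card_def rho_point_eq_def big_def
  by (auto intro: lepoll_trans RO_lepoll_down regs_open)

lemma X_card_small:
  assumes "p \<in> X_card X L"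
  shows "\<exists>U. small X L U \<and> p \<in> U"
proof -
  obtain G where G: "openin X G" "p \<in> G" "RO X G \<approx> L"
    using assms unfolding X_card_def rho_point_eq_def by auto
  then have "down X (reg X G) \<lesssim> L"
    using lepoll_trans2[OF down_reg_lepoll_RO] by blast
  then show ?thesis
    using subset_reg[OF G(1)] G(2) unfolding small_def by (intro exI[of _ "reg X G"]) auto
qed

lemma regular_open_neighbourhood:
  assumes "regular_space X" "openin X U" "p \<in> U"
  shows "\<exists>V\<in>regs X. p \<in> V \<and> V \<subseteq> U \<and> X closure_of V \<subseteq> U"
proof -
  have "closedin X (topspace X - U)" "p \<in> topspace X - (topspace X - U)"
    using assms openin_subset by auto
  then obtain V where V: "openin X V" "p \<in> V" "disjnt (topspace X - U) (X closure_of V)"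
    using assms(1) unfolding regular_space by meson
  have "X closure_of (reg X V) \<subseteq> X closure_of V"
    by (simp add: closure_of_minimal reg_subset_closure)
  also have "\<dots> \<subseteq> U" using V(3) closure_of_subset_topspace[of X V] unfolding disjnt_def by auto
  finally have cl: "X closure_of (reg X V) \<subseteq> U" .
  moreover have "reg X V \<subseteq> X closure_of (reg X V)"
    by (simp add: closure_of_subset openin_subset)
  ultimately show ?thesis using subset_reg[OF V(1)] V(2) by (intro bexI[of _ "reg X V"]) auto
qed

text \<open>Keep the neighbourhoods that contain no neighbourhood earlier in a fixed well-order. The
  earliest one inside \<open>B\<close> is kept, and along an increasing sequence of kept sets each
  term is earlier than the one before.\<close>

lemma exists_noetherian_local_base:
  "\<exists>N. (\<forall>B\<in>N. openin X B \<and> p \<in> B \<and> B \<subseteq> U) \<and>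
    (\<forall>B. openin X B \<longrightarrow> p \<in> B \<longrightarrow> B \<subseteq> U \<longrightarrow> (\<exists>B'\<in>N. B' \<subseteq> B)) \<and> noetherian N"
proof -
  define r where "r = card_less (UNIV :: 'a set set)"
  have wf: "wf r" unfolding r_def by (rule wf_card_less)
  define Q where "Q = {B. openin X B \<and> p \<in> B \<and> B \<subseteq> U}"
  define N where "N = {B \<in> Q. \<forall>B'\<in>Q. B' \<subseteq> B \<longrightarrow> (B', B) \<notin> r}"
  have "\<exists>B'\<in>N. B' \<subseteq> B" if "B \<in> Q" for B
  proof -
    have "B \<in> {B' \<in> Q. B' \<subseteq> B}" using that by auto
    from wf[unfolded wf_eq_minimal, rule_format, OF this]
    obtain B' where B': "B' \<in> {B' \<in> Q. B' \<subseteq> B}" and min: "\<forall>C. (C, B') \<in> r \<longrightarrow> C \<notin> {B' \<in> Q. B' \<subseteq> B}"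
      by (elim bexE)
    then have "B' \<in> N" unfolding N_def by auto
    then show ?thesis using B' by auto
  qed
  moreover have "noetherian N"
    unfolding noetherian_def
  proof
    assume "\<exists>f :: nat \<Rightarrow> _. \<forall>n. f n \<in> N \<and> f n \<subset> f (Suc n)"
    then obtain f :: "nat \<Rightarrow> _" where "\<forall>n. f n \<in> N \<and> f n \<subset> f (Suc n)" by (elim exE)
    then have f: "\<And>n. f n \<in> N" "\<And>n. f n \<subset> f (Suc n)" by auto
    have "(f (Suc n), f n) \<in> r" for n
    proof -
      have "f n \<in> Q" "f n \<subseteq> f (Suc n)" using f unfolding N_def by auto
      then have "(f n, f (Suc n)) \<notin> r" using f(1)[of "Suc n"] unfolding N_def by auto
      moreover have "f n \<noteq> f (Suc n)" using f(2)[of n] by auto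
      ultimately show ?thesis
        using total_card_less[of "f n" UNIV "f (Suc n)"] unfolding r_def by auto
    qed
    then show False using wf unfolding wf_iff_no_infinite_down_chain by blast
  qed
  ultimately show ?thesis unfolding N_def Q_def by (intro exI[of _ N]) (auto simp: N_def Q_def)
qed

text \<open>Holds at the second kind of points in the overview and fails at the first.\<close>

definition splittable_at where
  "splittable_at p \<longleftrightarrow> (\<forall>U\<in>regs X. p \<in> U \<longrightarrow> (\<exists>W\<subseteq>U. big X L W \<and> p \<notin> X closure_of W))"

text \<open>If a base set \<open>B\<close> at \<open>p\<close> lies in the distinguished neighbourhood of a different point \<open>q\<close>,
  then a neighbourhood of \<open>p\<close> in \<open>B\<close> with \<open>q\<close> outside its closure is big, which is excluded. Hence
  chains never change their point.\<close>
lemma outer_base_not_splittable: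
  assumes reg: "regular_space X" and t1: "t1_space X"
  shows "\<exists>\<B>. outer_base X \<B> {p \<in> X_card X L. \<not> splittable_at p} \<and> noetherian \<B>"
proof -
  let ?P = "{p \<in> X_card X L. \<not> splittable_at p}"
  have "\<forall>p\<in>?P. \<exists>U. U \<in> regs X \<and> p \<in> U \<and> (\<forall>W\<subseteq>U. big X L W \<longrightarrow> p \<in> X closure_of W)"
    unfolding splittable_at_def by auto
  from bchoice[OF this] obtain U
    where U: "\<forall>p\<in>?P. U p \<in> regs X \<and> p \<in> U p \<and> (\<forall>W\<subseteq>U p. big X L W \<longrightarrow> p \<in> X closure_of W)"
    by (elim exE)
  have "\<forall>p. \<exists>N. (\<forall>B\<in>N. openin X B \<and> p \<in> B \<and> B \<subseteq> U p) \<and>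
    (\<forall>B. openin X B \<longrightarrow> p \<in> B \<longrightarrow> B \<subseteq> U p \<longrightarrow> (\<exists>B'\<in>N. B' \<subseteq> B)) \<and> noetherian N"
    by (intro allI exists_noetherian_local_base)
  from choice[OF this] obtain N where N0: "\<forall>p. (\<forall>B\<in>N p. openin X B \<and> p \<in> B \<and> B \<subseteq> U p) \<and>
    (\<forall>B. openin X B \<longrightarrow> p \<in> B \<longrightarrow> B \<subseteq> U p \<longrightarrow> (\<exists>B'\<in>N p. B' \<subseteq> B)) \<and> noetherian (N p)"
    by (elim exE)
  have Nb: "openin X B" "p \<in> B" "B \<subseteq> U p" if "B \<in> N p" for p B
    using N0 that by blast+
  have Nl: "\<exists>B'\<in>N p. B' \<subseteq> B" if "openin X B" "p \<in> B" "B \<subseteq> U p" for p B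
    using N0 that by blast
  have Nn: "noetherian (N p)" for p using N0 by blast
  let ?B = "\<Union>p\<in>?P. N p"
  have "outer_base X ?B ?P"
    unfolding outer_base_def
  proof (intro conjI ballI allI impI)
    show "openin X B" if "B \<in> ?B" for B using Nb(1) that by blast
    fix p V assume p: "p \<in> ?P" and V: "openin X V \<and> p \<in> V"
    have "openin X (V \<inter> U p)" "p \<in> V \<inter> U p"
      using bspec[OF U p] V by (simp_all add: openin_Int regs_open)
    then obtain B where "B \<in> N p" "B \<subseteq> V \<inter> U p" using Nl[of "V \<inter> U p" p] by auto
    then show "\<exists>B\<in>?B. p \<in> B \<and> B \<subseteq> V" using Nb(2)[of B p] p by (intro bexI[of _ B]) auto
  qed
  moreover have "noetherian ?B"
    unfolding noetherian_def
  proof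
    assume "\<exists>f :: nat \<Rightarrow> _. \<forall>n. f n \<in> ?B \<and> f n \<subset> f (Suc n)"
    then obtain f :: "nat \<Rightarrow> _" where "\<forall>n. f n \<in> ?B \<and> f n \<subset> f (Suc n)" by (elim exE)
    then have f: "\<And>n. f n \<in> ?B" "\<And>n. f n \<subset> f (Suc n)" by auto
    from f(1) have "\<forall>n. \<exists>p. p \<in> ?P \<and> f n \<in> N p" by auto
    then obtain p where p: "\<And>n. p n \<in> ?P" "\<And>n. f n \<in> N (p n)" by metis
    have "p (Suc n) = p n" for n
    proof (rule ccontr)
      assume ne: "p (Suc n) \<noteq> p n"
      have fn: "openin X (f n)" "p n \<in> f n" using Nb(1,2)[OF p(2)[of n]] by auto
      have "p (Suc n) \<in> topspace X" using p(1)[of "Suc n"] unfolding X_card_def by auto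
      then have "closedin X {p (Suc n)}" using t1 by (simp add: closedin_t1_singleton)
      then have "openin X (f n - {p (Suc n)})" by (rule openin_diff[OF fn(1)])
      then obtain V where V: "V \<in> regs X" "p n \<in> V" "V \<subseteq> f n - {p (Suc n)}"
        "X closure_of V \<subseteq> f n - {p (Suc n)}"
        using regular_open_neighbourhood[OF reg, of "f n - {p (Suc n)}" "p n"] fn ne by auto
      have "p n \<in> X_card X L" using p(1)[of n] by simp
      then have "big X L V" using V by (intro X_card_big)
      moreover have "V \<subseteq> U (p (Suc n))"
        using Nb(3)[OF p(2)[of "Suc n"]] V(3) f(2)[of n] by blast
      ultimately show False using U p(1)[of "Suc n"] V(4) by blast
    qed
    then have "p n = p 0" for n by (induction n) auto
    then have "\<forall>n. f n \<in> N (p 0) \<and> f n \<subset> f (Suc n)" using p(2) f(2) by metis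
    then show False by (rule noetherianD[OF Nn])
  qed
  ultimately show ?thesis by blast
qed

text \<open>In a small \<open>U\<close> there is a big \<open>W\<close> that misses
  \<open>p\<close>; then \<open>U\<close> is counted in \<open>down U\<close> but not in
  \<open>down W\<close>, and for finite \<open>L\<close> the bounds on both sizes contradict
  this.\<close>

lemma splittable_infinite:
  assumes "p \<in> X_card X L" "splittable_at p"
  shows "infinite L"
proof
  assume fin: "finite L"
  obtain U where U: "small X L U" "p \<in> U" using X_card_small[OF assms(1)] by auto
  then have UR: "U \<in> regs X" and le: "down X U \<lesssim> L" unfolding small_def by auto
  then obtain W where W: "W \<subseteq> U" "big X L W" "p \<notin> X closure_of W"
    using assms(2) U(2) unfolding splittable_at_def by blast
  have "W \<noteq> U" using W(3) U(2) closure_of_subset[OF openin_subset[OF regs_open[OF UR]]] by auto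
  then have "U \<in> down X U" "U \<notin> down X W" "down X W \<subseteq> down X U" using W(1) UR by (auto simp: down_def)
  then have lt: "down X W \<subset> down X U" by blast
  have "finite (down X U)" using lepoll_finite[OF le fin] .
  then have "card (down X W) < card (down X U)" using lt by (rule psubset_card_mono)
  moreover have "card (down X U) \<le> card L"
    using le fin \<open>finite (down X U)\<close> by (simp add: lepoll_iff_card_le)
  moreover have "card L \<le> card (down X W)"
    using W(2) fin finite_subset[OF _ \<open>finite (down X U)\<close>] lt unfolding big_def
    by (simp add: lepoll_iff_card_le psubset_imp_subset)
  ultimately show False by simp
qed

text \<open>The members only have to meet \<open>U\<close> in big sets and may stick out of it; this
  lets a pair usable for one term of a chain stay usable for the next.\<close>

definition usable where
  "usable U c \<longleftrightarrow> (\<exists>S. coding X L (fst c) S) \<and> (\<exists>S. coding X L (snd c) S) \<and>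
     fst c \<in> regs X \<and> snd c \<in> regs X \<and> X closure_of fst c \<inter> X closure_of snd c = {} \<and>
     big X L (U \<inter> fst c) \<and> big X L (U \<inter> snd c)"

text \<open>The first set is taken away from \<open>q\<close>, the second inside a neighbourhood of
  \<open>q\<close> whose closure misses that of the first; both are then shrunk to sets with a
  coding.\<close>

lemma exists_usable:
  assumes reg: "regular_space X" and q: "splittable_at q" and U: "U \<in> regs X" "q \<in> U"
    and inf: "infinite L"
  shows "\<exists>c. usable U c"
proof -
  obtain W where W: "W \<subseteq> U" "big X L W" "q \<notin> X closure_of W"
    using q U unfolding splittable_at_def by blast
  then have "openin X (U - X closure_of W)" "q \<in> U - X closure_of W"
    using U by (auto intro: openin_diff regs_open)
  then obtain V where V: "V \<in> regs X" "q \<in> V" "V \<subseteq> U - X closure_of W" "X closure_of V \<subseteq> U - X closure_of W"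
    using regular_open_neighbourhood[OF reg] by meson
  obtain W' where W': "W' \<subseteq> V" "big X L W'"
    using q V(1,2) unfolding splittable_at_def by blast
  obtain C where C: "C \<subseteq> W" "big X L C" "\<exists>S. coding X L C S" using exists_coding[OF inf W(2)] by auto
  obtain C' where C': "C' \<subseteq> W'" "big X L C'" "\<exists>S. coding X L C' S" using exists_coding[OF inf W'(2)] by auto
  have "X closure_of C \<subseteq> X closure_of W" "X closure_of C' \<subseteq> X closure_of V"
    using C(1) C'(1) W'(1) by (auto intro!: closure_of_mono)
  then have "X closure_of C \<inter> X closure_of C' = {}" using V(4) by auto
  moreover have "U \<inter> C = C" "U \<inter> C' = C'" using C(1) C'(1) W(1) W'(1) V(3) by auto
  ultimately have "usable U (C, C')" using C C' unfolding usable_def big_def by auto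
  then show ?thesis by blast
qed

text \<open>Each side \<open>b\<close> of the least usable pair gives a Noetherian family. Since the
  closures of the sides are disjoint, a point is outside one of them, and the two families together
  form an outer base.\<close>

lemma outer_base_splittable:
  assumes reg: "regular_space X" and inf: "infinite L"
  shows "\<exists>\<B>. outer_base X \<B> {p \<in> X_card X L. splittable_at p} \<and> noetherian \<B>"
proof -
  obtain col where col: "\<And>A. small X L A \<Longrightarrow> col A \<in> L"
    and col_eq: "\<And>A B. small X L A \<Longrightarrow> small X L B \<Longrightarrow> A \<subseteq> B \<Longrightarrow> col A = col B \<Longrightarrow> A = B"
    using exists_regular_open_coloring[OF inf, of X] by (elim exE conjE) (rule that, auto)
  define r where "r = card_less (UNIV :: ('a set \<times> 'a set) set)"
  have wf: "wf r" unfolding r_def by (rule wf_card_less)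
  have "\<forall>U\<in>{U. \<exists>c. usable U c}. \<exists>c. usable U c \<and> (\<forall>c'. usable U c' \<longrightarrow> (c', c) \<notin> r)"
  proof
    fix U assume "U \<in> {U. \<exists>c. usable U c}"
    then obtain c where "c \<in> {c. usable U c}" by auto
    from wf[unfolded wf_eq_minimal, rule_format, OF this]
    obtain d where "d \<in> {c. usable U c}" "\<forall>c'. (c', d) \<in> r \<longrightarrow> c' \<notin> {c. usable U c}"
      by (elim bexE)
    then show "\<exists>c. usable U c \<and> (\<forall>c'. usable U c' \<longrightarrow> (c', c) \<notin> r)" by (intro exI[of _ d]) blast
  qed
  from bchoice[OF this] obtain c
    where c: "\<forall>U\<in>{U. \<exists>c. usable U c}. usable U (c U) \<and> (\<forall>c'. usable U c' \<longrightarrow> (c', c U) \<notin> r)"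
    by (elim exE)
  have c_usable: "usable U (c U)" and c_min: "\<And>c'. usable U c' \<Longrightarrow> (c', c U) \<notin> r" if "usable U d" for U d
    using c that by blast+
  define sel where "sel b d = (if b then fst d else snd d)" for b and d :: "'a set \<times> 'a set"
  have sel: "\<exists>S. coding X L (sel b d) S" "sel b d \<in> regs X" "X closure_of (sel b d) \<inter> sel (\<not> b) d = {}"
    "big X L (U \<inter> sel b d)" if "usable U d" for b U d
  proof -
    have "fst d \<subseteq> X closure_of fst d" "snd d \<subseteq> X closure_of snd d"
      using that unfolding usable_def by (auto intro!: closure_of_subset openin_subset regs_open)
    then show "\<exists>S. coding X L (sel b d) S" "sel b d \<in> regs X" "X closure_of (sel b d) \<inter> sel (\<not> b) d = {}"
      "big X L (U \<inter> sel b d)"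
      using that unfolding usable_def sel_def by (auto split: if_splits)
  qed
  define S where "S C = (SOME S. coding X L C S)" for C
  have S: "coding X L (sel b d) (S (sel b d))" if "usable U d" for b U d
    unfolding S_def by (rule someI_ex[OF sel(1)[OF that]])
  \<comment> \<open>Outside the closure of side \<open>b\<close> nothing changes; within that
    closure only a code for the colour of the outer part remains.\<close>
  define B where "B b U = (U - X closure_of (sel b (c U))) \<union>
      S (sel b (c U)) (U \<inter> sel b (c U)) (col (U - X closure_of (sel b (c U))))" for b U
  have small_diff: "small X L (U - X closure_of (sel b d))" if "small X L U" "usable U d" for b U d
    using that sel(2)[OF that(2)] by (intro small_subset[OF that(1)]) (auto simp: small_def regs_diff regs_open)
  have S_big: "big X L (S (sel b (c U)) (U \<inter> sel b (c U)) (col (U - X closure_of (sel b (c U)))))"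
    and S_sub: "S (sel b (c U)) (U \<inter> sel b (c U)) (col (U - X closure_of (sel b (c U)))) \<subseteq> U \<inter> sel b (c U)"
    if "small X L U" "usable U d" for b U d
    using S[OF c_usable[OF that(2)], of b] sel(4)[OF c_usable[OF that(2)], of b]
      col[OF small_diff[OF that(1) c_usable[OF that(2)]], of b]
    unfolding coding_def by auto
  have cl: "sel b d \<subseteq> X closure_of (sel b d)" if "usable U d" for b U d
    using sel(2)[OF that] by (intro closure_of_subset openin_subset regs_open)
  have B_sub: "B b U \<subseteq> U" if "small X L U" "usable U d" for b U d
    using S_sub[OF that, of b] unfolding B_def by auto
  have B_Int: "B b U \<inter> sel b (c U) = S (sel b (c U)) (U \<inter> sel b (c U)) (col (U - X closure_of (sel b (c U))))"
    and B_diff: "B b U - X closure_of (sel b (c U)) = U - X closure_of (sel b (c U))"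
    if "small X L U" "usable U d" for b U d
    using S_sub[OF that, of b] cl[OF c_usable[OF that(2)], of b] unfolding B_def by blast+
  define \<B> where "\<B> b = {B b U |U. small X L U \<and> (\<exists>d. usable U d)}" for b
  have noeth: "noetherian (\<B> b)" for b
    unfolding noetherian_def
  proof
    assume "\<exists>f :: nat \<Rightarrow> _. \<forall>n. f n \<in> \<B> b \<and> f n \<subset> f (Suc n)"
    then obtain f :: "nat \<Rightarrow> _" where "\<forall>n. f n \<in> \<B> b \<and> f n \<subset> f (Suc n)" by (elim exE)
    then have f: "\<And>n. f n \<in> \<B> b" "\<And>n. f n \<subset> f (Suc n)" by auto
    from f(1) have "\<forall>n. \<exists>U. f n = B b U \<and> small X L U \<and> (\<exists>d. usable U d)" unfolding \<B>_def by blast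
    then obtain U where U: "\<And>n. f n = B b (U n)" "\<And>n. small X L (U n)" "\<And>n. \<exists>d. usable (U n) d"
      by metis
    have us: "usable (U n) (c (U n))" for n using U(3)[of n] c_usable by blast
    have UR: "U n \<in> regs X" for n using U(2) unfolding small_def by auto
    \<comment> \<open>On side \<open>b\<close> the code is a big subset. The other side misses the
      closure of side \<open>b\<close>, so its part of \<open>U n\<close> lies in
      \<open>B b (U n)\<close> and hence in \<open>U (Suc n)\<close>.\<close>
    have step: "usable (U (Suc n)) (c (U n))" for n
    proof -
      have sub: "B b (U n) \<subseteq> U (Suc n)"
        using f(2)[of n] B_sub[OF U(2)[of "Suc n"] us[of "Suc n"], of b] unfolding U(1) by auto
      have "big X L (U (Suc n) \<inter> sel b (c (U n)))"
        by (rule big_mono[OF S_big[OF U(2)[of n] us[of n], of b]])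
          (use B_Int[OF U(2)[of n] us[of n], of b] sub UR sel(2)[OF us] in \<open>auto simp: regs_Int\<close>)
      moreover have "U n \<inter> sel (\<not> b) (c (U n)) \<subseteq> U (Suc n) \<inter> sel (\<not> b) (c (U n))"
        using sub sel(3)[OF us[of n], of b] unfolding B_def by blast
      then have "big X L (U (Suc n) \<inter> sel (\<not> b) (c (U n)))"
        by (rule big_mono[OF sel(4)[OF us]]) (simp add: regs_Int UR sel(2)[OF us])
      ultimately show ?thesis using us[of n] unfolding usable_def sel_def by (auto split: if_splits)
    qed
    \<comment> \<open>By \<open>step\<close> the old pair competes for the new set, so the least
      usable pair cannot move up.\<close>
    have "(c (U (Suc n)), c (U n)) \<in> r \<or> c (U (Suc n)) = c (U n)" for n
      using c_min[OF us[of "Suc n"] step[of n]] total_card_less[of "c (U n)" UNIV "c (U (Suc n))"] unfolding r_def by auto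
    from wf_descending_eventually_constant[OF wf, of "\<lambda>n. c (U n)", OF this]
    obtain m where m: "\<forall>n\<ge>m. c (U n) = c (U m)" by (elim exE)
    define C where "C = sel b (c (U m))"
    have Cn: "sel b (c (U (m + n))) = C" for n using m[rule_format, of "m + n"] unfolding C_def by simp
    define A where "A n = U (m + n) \<inter> C" for n
    define i where "i n = col (U (m + n) - X closure_of C)" for n
    have f_Int: "f (m + n) \<inter> C = S C (A n) (i n)" and f_diff: "f (m + n) - X closure_of C = U (m + n) - X closure_of C" for n
      using B_Int[OF U(2)[of "m + n"] us[of "m + n"], of b] B_diff[OF U(2)[of "m + n"] us[of "m + n"], of b]
      unfolding U(1) Cn A_def i_def by auto
    have sm: "small X L (U (m + n) - X closure_of C)" for n
      using small_diff[OF U(2)[of "m + n"] us[of "m + n"], of b] unfolding Cn .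
    have "big X L (A n) \<and> A n \<subseteq> C \<and> i n \<in> L \<and> S C (A n) (i n) \<subseteq> S C (A (Suc n)) (i (Suc n))" for n
    proof (intro conjI)
      show "big X L (A n)" using sel(4)[OF us[of "m + n"], of b] unfolding Cn A_def .
      show "A n \<subseteq> C" unfolding A_def by auto
      show "i n \<in> L" unfolding i_def by (rule col[OF sm])
      show "S C (A n) (i n) \<subseteq> S C (A (Suc n)) (i (Suc n))"
        using f_Int[of n] f_Int[of "Suc n"] f(2)[of "m + n"] by auto
    qed
    note chain = this
    have "coding X L C (S C)" unfolding C_def by (rule S[OF us])
    from conjunct2[OF this[unfolded coding_def], rule_format, of A i, OF chain]
    obtain m' where m': "\<forall>n\<ge>m'. i n = i m' \<and> S C (A n) (i n) = S C (A m') (i m')"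
      by (elim exE)
    \<comment> \<open>From here code and colour agree with their successors; the outer parts are
      nested with equal colour, hence equal, which contradicts the strict inclusion of
      \<open>f ?k\<close> in the next term.\<close>
    let ?k = "m + m'"
    have "i m' = i (Suc m')" and SS: "S C (A m') (i m') = S C (A (Suc m')) (i (Suc m'))"
      by (rule conjunct1[OF m'[rule_format, OF le_SucI[OF order_refl]], symmetric],
          rule conjunct2[OF m'[rule_format, OF le_SucI[OF order_refl]], symmetric])
    moreover have "U ?k - X closure_of C \<subseteq> U (m + Suc m') - X closure_of C"
      using f_diff[of m'] f_diff[of "Suc m'"] f(2)[of ?k] by auto
    ultimately have UU: "U ?k - X closure_of C = U (m + Suc m') - X closure_of C"
      unfolding i_def by (intro col_eq sm)
    have "f ?k = f (m + Suc m')"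
      unfolding U(1) B_def Cn using UU SS unfolding A_def i_def by simp
    then show False using f(2)[of ?k] by simp
  qed
  have "outer_base X (\<B> True \<union> \<B> False) {p \<in> X_card X L. splittable_at p}"
    unfolding outer_base_def
  proof (intro conjI ballI allI impI)
    fix E assume "E \<in> \<B> True \<union> \<B> False"
    then obtain b U d where E: "E = B b U" "small X L U" "usable U d" unfolding \<B>_def by blast
    then have "openin X (U - X closure_of (sel b (c U)))" unfolding small_def by (auto intro: openin_diff regs_open)
    then show "openin X E"
      using S_big[OF E(2,3), of b] unfolding E(1) B_def big_def by (auto intro: openin_Un regs_open)
  next
    fix q V assume q: "q \<in> {p \<in> X_card X L. splittable_at p}" and V: "openin X V \<and> q \<in> V"
    obtain U0 where U0: "small X L U0" "q \<in> U0" using X_card_small q by blast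
    then have "openin X (U0 \<inter> V)" "q \<in> U0 \<inter> V" using V unfolding small_def by (auto intro: regs_open)
    then obtain U where U: "U \<in> regs X" "q \<in> U" "U \<subseteq> U0 \<inter> V"
      using regular_open_neighbourhood[OF reg] by meson
    then have Us: "small X L U" using small_subset[OF U0(1)] by auto
    obtain d where d: "usable U d" using exists_usable[OF reg _ U(1,2) inf] q by auto
    then have "\<exists>b. q \<notin> X closure_of (sel b (c U))"
      using c_usable[OF d] unfolding usable_def sel_def by (metis disjoint_iff)
    then obtain b where "q \<in> B b U" using U(2) unfolding B_def by auto
    moreover have "B b U \<in> \<B> b" using Us d unfolding \<B>_def by blast
    then have "B b U \<in> \<B> True \<union> \<B> False" by (cases b) auto
    ultimately show "\<exists>E\<in>\<B> True \<union> \<B> False. q \<in> E \<and> E \<subseteq> V"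
      using B_sub[OF Us d, of b] U(3) by blast
  qed
  then show ?thesis using noetherian_Un[OF noeth noeth] by blast
qed

end

lemma outer_base_Un:
  "outer_base X A P \<Longrightarrow> outer_base X B Q \<Longrightarrow> outer_base X (A \<union> B) (P \<union> Q)"
  unfolding outer_base_def by (auto 0 4)

theorem theorem3:
  fixes X :: "'a topology" and L :: "'b set"
  assumes "T3_space X"
  shows "\<exists>\<B>. outer_base X \<B> (X_card X L) \<and> noetherian \<B>"
proof -
  have X: "regular_space X" "t1_space X" using assms unfolding T3_space_def by auto
  obtain \<B> where \<B>: "outer_base X \<B> {p \<in> X_card X L. \<not> splittable_at X L p}" "noetherian \<B>"
    using outer_base_not_splittable[OF X] by blast
  show ?thesis
  proof (cases "infinite L")
    case True
    then obtain \<C> where \<C>: "outer_base X \<C> {p \<in> X_card X L. splittable_at X L p}" "noetherian \<C>"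
      using outer_base_splittable[OF X(1)] by blast
    have "{p \<in> X_card X L. \<not> splittable_at X L p} \<union> {p \<in> X_card X L. splittable_at X L p} = X_card X L"
      by auto
    then have "outer_base X (\<B> \<union> \<C>) (X_card X L)"
      using outer_base_Un[OF \<B>(1) \<C>(1)] by simp
    moreover have "noetherian (\<B> \<union> \<C>)" by (rule noetherian_Un[OF \<B>(2) \<C>(2)])
    ultimately show ?thesis by blast
  next
    case False
    then have "\<not> splittable_at X L p" if "p \<in> X_card X L" for p
      using splittable_infinite[OF that] by auto
    then have "{p \<in> X_card X L. \<not> splittable_at X L p} = X_card X L" by auto
    then show ?thesis using \<B> by auto
  qed
qed

end
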